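(* A planar three-body motion $\Gamma(t)$ (Newtonian, in the $xy$-plane, with angular momentum $\Omega\mathbf k$) whose initial position $\Gamma(t_0)$ is not collinear is completely determined by its moduli curve $\bar\Gamma(t)$, its initial position $\Gamma(t_0)$ and its angular momentum vector. The curve $\bar\Gamma(t)$ is a solution of the $\Omega$-reduced Newton's equation $$\ddot I_i=4T_i-\Big(\frac{m_i+2m_{i+1}}{r_{i,i+1}^3}+\frac{m_i+2m_{i+2}}{r_{i,i+2}^3}\Big)I_i-\Big(\frac1{r_{i,i+1}^3}-\frac1{r_{i,i+2}^3}\Big)\big(m_{i+1}I_{i+1}-m_{i+2}I_{i+2}\big),\qquad i\ (\mathrm{mod}\ 3),$$ with kinetic energy terms $T_i=\frac{\dot I_i^2}{8I_i}+\frac12\omega_i^2I_i$, where $\omega_i=\omega_i^0+\frac{\Omega}{I}$. Conversely, each solution curve of this $\Omega$-reduced Newton's equation can be realized as the moduli curve of a three-body motion in the $xy$-plane, with a given (non-collinear) initial position and with $\Omega\mathbf k$ as the conserved angular momentum.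
   Context: Masses $m_1,m_2,m_3>0$, $m_1+m_2+m_3=1$; position vectors $\mathbf a_i$ with $\sum m_i\mathbf a_i=0$; a three-body motion solves Newton's equations $m_i\ddot{\mathbf a}_i=\sum_{j\ne i}\frac{m_im_j}{r_{ij}^3}(\mathbf a_j-\mathbf a_i)$ with $r_{ij}=|\mathbf a_i-\mathbf a_j|$. Angular momentum $\mathbf\Omega=\sum m_i\mathbf a_i\times\dot{\mathbf a}_i$. $I_i=m_i|\mathbf a_i|^2$, $I=\sum I_i$; the mutual distances are given by $r_{jk}^2=\frac{(1-m_i)I-I_i}{m_jm_k}$ for $\{i,j,k\}=\{1,2,3\}$. The moduli curve is the image of the motion modulo rotations (with orientation), described locally by $(I_1,I_2,I_3)$. With $\alpha_j$ the central angle between $\mathbf a_{j+1}$ and $\mathbf a_{j+2}$, $\Delta$ the triangle area and $C_1=-m_1I_1+m_2I_2+m_3I_3$ (cyclic), $\omega_1^0=\frac1I(I_3\dot\alpha_2-I_2\dot\alpha_3)=\frac{1}{8m_1m_2m_3\Delta I}[(C_3I_3-C_2I_2)\frac{\dot I_1}{I_1}-(C_1+2m_2I_3)\dot I_2+(C_1+2m_3I_2)\dot I_3]$, and $\omega_2^0,\omega_3^0$ by cyclic permutation; $\omega_i$ is the scalar angular velocity of $\mathbf a_i$. *)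

theory Defs
  imports "HOL-Analysis.Analysis"
begin

text \<open>Conventions. Bodies are indexed 0,1,2 (the paper's 1,2,3); index arithmetic is mod 3.
  The xy-plane is identified with the complex plane; a planar motion is
  a :: nat => real => complex, with a i t the position of body i at time t.
  A mass vector is m :: nat => real (only m 0, m 1, m 2 matter).\<close>

definition masses_ok :: "(nat \<Rightarrow> real) \<Rightarrow> bool" where
  "masses_ok m \<longleftrightarrow> (\<forall>i<3. 0 < m i) \<and> m 0 + m 1 + m 2 = 1"

definition cross2 :: "complex \<Rightarrow> complex \<Rightarrow> real" where
  "cross2 x y = Im (cnj x * y)"

definition three_body_motion ::
  "(nat \<Rightarrow> real) \<Rightarrow> (nat \<Rightarrow> real \<Rightarrow> complex) \<Rightarrow> real set \<Rightarrow> bool" where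
  "three_body_motion m a J \<longleftrightarrow>
     (\<forall>t\<in>J. (\<Sum>i<3. complex_of_real (m i) * a i t) = 0) \<and>
     (\<forall>t\<in>J. \<forall>i<3. \<forall>j<3. i \<noteq> j \<longrightarrow> a i t \<noteq> a j t) \<and>
     (\<forall>i<3. \<forall>t\<in>J.
        (a i has_vector_derivative vector_derivative (a i) (at t)) (at t) \<and>
        ((\<lambda>s. vector_derivative (a i) (at s)) has_vector_derivative
            (vector_derivative (\<lambda>s. vector_derivative (a i) (at s)) (at t))) (at t) \<and>
        complex_of_real (m i) * vector_derivative (\<lambda>s. vector_derivative (a i) (at s)) (at t) =
          (\<Sum>j\<in>{..<3} - {i}. complex_of_real (m i * m j / (cmod (a i t - a j t)) ^ 3)
                                 * (a j t - a i t)))"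

definition ang_mom :: "(nat \<Rightarrow> real) \<Rightarrow> (nat \<Rightarrow> real \<Rightarrow> complex) \<Rightarrow> real \<Rightarrow> real" where
  "ang_mom m a t = (\<Sum>i<3. m i * cross2 (a i t) (vector_derivative (a i) (at t)))"

text \<open>Oriented triangle area of a configuration p :: nat => complex (positive if p0,p1,p2 is
  counterclockwise); collinear iff it vanishes.\<close>
definition signed_area :: "(nat \<Rightarrow> complex) \<Rightarrow> real" where
  "signed_area p = cross2 (p 1 - p 0) (p 2 - p 0) / 2"

definition collinear3 :: "(nat \<Rightarrow> complex) \<Rightarrow> bool" where
  "collinear3 p \<longleftrightarrow> signed_area p = 0"

definition Imom :: "(nat \<Rightarrow> real) \<Rightarrow> (nat \<Rightarrow> real \<Rightarrow> complex) \<Rightarrow> nat \<Rightarrow> real \<Rightarrow> real" where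
  "Imom m a i t = m i * (cmod (a i t))\<^sup>2"

text \<open>Quantities on the moduli space, expressed through a triple I :: nat => real
  (I 0, I 1, I 2) and an orientation eps in {1,-1}.\<close>

definition Itot :: "(nat \<Rightarrow> real) \<Rightarrow> real" where
  "Itot I = I 0 + I 1 + I 2"

text \<open>r_{jk}^2 = ((1 - m_i) I - I_i)/(m_j m_k), {i,j,k} = {0,1,2} (for j,k distinct, i = 3-j-k).\<close>
definition rsq :: "(nat \<Rightarrow> real) \<Rightarrow> (nat \<Rightarrow> real) \<Rightarrow> nat \<Rightarrow> nat \<Rightarrow> real" where
  "rsq m I j k = ((1 - m (3 - j - k)) * Itot I - I (3 - j - k)) / (m j * m k)"

definition rdist :: "(nat \<Rightarrow> real) \<Rightarrow> (nat \<Rightarrow> real) \<Rightarrow> nat \<Rightarrow> nat \<Rightarrow> real" where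
  "rdist m I j k = sqrt (rsq m I j k)"

text \<open>Heron: 16 Delta^2 in terms of the squared side lengths.\<close>
definition heron16 :: "(nat \<Rightarrow> real) \<Rightarrow> (nat \<Rightarrow> real) \<Rightarrow> real" where
  "heron16 m I = (let x = rsq m I 0 1; y = rsq m I 1 2; z = rsq m I 0 2 in
                   2 * (x * y + y * z + z * x) - (x\<^sup>2 + y\<^sup>2 + z\<^sup>2))"

definition Delta_mod :: "(nat \<Rightarrow> real) \<Rightarrow> real \<Rightarrow> (nat \<Rightarrow> real) \<Rightarrow> real" where
  "Delta_mod m eps I = eps * sqrt (heron16 m I) / 4"

definition noncollinear_mod :: "(nat \<Rightarrow> real) \<Rightarrow> (nat \<Rightarrow> real) \<Rightarrow> bool" where
  "noncollinear_mod m I \<longleftrightarrow> rsq m I 0 1 > 0 \<and> rsq m I 1 2 > 0 \<and> rsq m I 0 2 > 0 \<and> heron16 m I > 0"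

definition Ccoef :: "(nat \<Rightarrow> real) \<Rightarrow> (nat \<Rightarrow> real) \<Rightarrow> nat \<Rightarrow> real" where
  "Ccoef m I i = - m i * I i + m ((i + 1) mod 3) * I ((i + 1) mod 3)
                 + m ((i + 2) mod 3) * I ((i + 2) mod 3)"

definition omega0 ::
  "(nat \<Rightarrow> real) \<Rightarrow> real \<Rightarrow> (nat \<Rightarrow> real) \<Rightarrow> (nat \<Rightarrow> real) \<Rightarrow> nat \<Rightarrow> real" where
  "omega0 m eps I I' i =
     (let j = (i + 1) mod 3; k = (i + 2) mod 3 in
      1 / (8 * m i * m j * m k * Delta_mod m eps I * Itot I) *
        ((Ccoef m I k * I k - Ccoef m I j * I j) * I' i / I i
         - (Ccoef m I i + 2 * m j * I k) * I' j
         + (Ccoef m I i + 2 * m k * I j) * I' k))"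

definition omega_mod ::
  "(nat \<Rightarrow> real) \<Rightarrow> real \<Rightarrow> real \<Rightarrow> (nat \<Rightarrow> real) \<Rightarrow> (nat \<Rightarrow> real) \<Rightarrow> nat \<Rightarrow> real" where
  "omega_mod m \<Omega> eps I I' i = omega0 m eps I I' i + \<Omega> / Itot I"

definition Tkin ::
  "(nat \<Rightarrow> real) \<Rightarrow> real \<Rightarrow> real \<Rightarrow> (nat \<Rightarrow> real) \<Rightarrow> (nat \<Rightarrow> real) \<Rightarrow> nat \<Rightarrow> real" where
  "Tkin m \<Omega> eps I I' i = (I' i)\<^sup>2 / (8 * I i) + (omega_mod m \<Omega> eps I I' i)\<^sup>2 * I i / 2"

definition reduced_newton ::
  "(nat \<Rightarrow> real) \<Rightarrow> real \<Rightarrow> real \<Rightarrow> (nat \<Rightarrow> real) \<Rightarrow> (nat \<Rightarrow> real) \<Rightarrow> (nat \<Rightarrow> real) \<Rightarrow> bool" where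
  "reduced_newton m \<Omega> eps I I' I'' \<longleftrightarrow>
     (\<forall>i<3. let j = (i + 1) mod 3; k = (i + 2) mod 3 in
        I'' i = 4 * Tkin m \<Omega> eps I I' i
                - ((m i + 2 * m j) / (rdist m I i j) ^ 3 + (m i + 2 * m k) / (rdist m I i k) ^ 3) * I i
                - (1 / (rdist m I i j) ^ 3 - 1 / (rdist m I i k) ^ 3) * (m j * I j - m k * I k))"

definition reduced_newton_at ::
  "(nat \<Rightarrow> real) \<Rightarrow> real \<Rightarrow> real \<Rightarrow> (nat \<Rightarrow> real \<Rightarrow> real) \<Rightarrow> real \<Rightarrow> bool" where
  "reduced_newton_at m \<Omega> eps Ib t \<longleftrightarrow>
     (\<forall>i<3. (Ib i has_real_derivative deriv (Ib i) t) (at t) \<and>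
            (deriv (Ib i) has_real_derivative deriv (deriv (Ib i)) t) (at t)) \<and>
     reduced_newton m \<Omega> eps (\<lambda>i. Ib i t) (\<lambda>i. deriv (Ib i) t) (\<lambda>i. deriv (deriv (Ib i)) t)"

definition reduced_solution ::
  "(nat \<Rightarrow> real) \<Rightarrow> real \<Rightarrow> real \<Rightarrow> (nat \<Rightarrow> real \<Rightarrow> real) \<Rightarrow> real set \<Rightarrow> bool" where
  "reduced_solution m \<Omega> eps Ib J \<longleftrightarrow>
     (\<forall>t\<in>J. noncollinear_mod m (\<lambda>i. Ib i t) \<and> reduced_newton_at m \<Omega> eps Ib t)"

definition same_moduli_curve ::
  "(nat \<Rightarrow> real \<Rightarrow> complex) \<Rightarrow> (nat \<Rightarrow> real \<Rightarrow> complex) \<Rightarrow> real set \<Rightarrow> bool" where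
  "same_moduli_curve a b J \<longleftrightarrow>
     (\<forall>t\<in>J. \<exists>u. cmod u = 1 \<and> (\<forall>i<3. b i t = u * a i t))"

end

theory Submission
  imports Defs
begin

text \<open>For a centred triangle the inner products of the position vectors, the mutual distances and the
  area are functions of the moments $I_i$, and the relative angular velocities of the bodies are
  functions of the $I_i$ and their rates. Given the total angular momentum this fixes each angular
  velocity as $\omega_i^0 + \Omega / I$, so the reduced equation says exactly that
  $m_i \ddot a_i$ minus the force on body $i$ is orthogonal to $a_i$.
  For the converse, place the triangle prescribed by the moments so that body 0 turns with the
  prescribed angular velocity; it then has angular momentum $\Omega$. The residual forces are
  orthogonal to the positions and have zero sum and zero torque, which forces them to vanish for a
  noncollinear triangle.\<close>

subsection \<open>Centred triangles and their moments\<close>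

text \<open>Three scalar equations suffice by a count: six residual components face three radial
  equations, two equations from the centre of mass and one from the angular momentum. No existence
  or uniqueness theorem for differential equations enters. The moduli curve is given, so only one
  rotation angle has to be recovered, and its velocity is an expression of first order in the
  moments. That order matters: a reduced curve has second derivatives without known continuity, yet
  a quantity built from the moments and their first derivatives is still differentiable, so its
  antiderivative is twice differentiable, as Newton's equation demands. One angle is enough because
  a noncollinear triangle of given orientation is fixed by its moments up to rotation: the quotient
  of the positions of bodies 1 and 0 is an explicit function of the moments, smooth where Heron's
  expression is positive.\<close>

abbreviation (input) moments :: "(nat \<Rightarrow> real) \<Rightarrow> (nat \<Rightarrow> complex) \<Rightarrow> nat \<Rightarrow> real" where
  "moments m p i \<equiv> m i * (cmod (p i))\<^sup>2"

abbreviation (input) moment_rates ::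
  "(nat \<Rightarrow> real) \<Rightarrow> (nat \<Rightarrow> complex) \<Rightarrow> (nat \<Rightarrow> complex) \<Rightarrow> nat \<Rightarrow> real" where
  "moment_rates m p v i \<equiv> 2 * m i * inner (p i) (v i)"

text \<open>Copies the right side of Newton's equation in \<open>three_body_motion\<close>, so that
  it can be folded there.\<close>

definition force :: "(nat \<Rightarrow> real) \<Rightarrow> (nat \<Rightarrow> complex) \<Rightarrow> nat \<Rightarrow> complex" where
  "force m p i = (\<Sum>j\<in>{..<3} - {i}. complex_of_real (m i * m j / (cmod (p i - p j)) ^ 3) * (p j - p i))"

lemma all_less_3: "(\<forall>i<3. P i) \<longleftrightarrow> P 0 \<and> P 1 \<and> P (2::nat)"
  by (auto simp: numeral_3_eq_3 less_Suc_eq numeral_2_eq_2)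

lemma sum_less_3: "(\<Sum>i<3. f i) = f 0 + f 1 + f (2::nat)"
  for f :: "nat \<Rightarrow> 'a::comm_monoid_add"
  by (simp add: numeral_3_eq_3 numeral_2_eq_2 add.assoc)

lemma less_3_cases: "i < 3 \<Longrightarrow> i = 0 \<or> i = 1 \<or> i = (2::nat)"
  by auto

lemma force_expand:
  "force m p 0 = (m 0 * m 1 / cmod (p 0 - p 1) ^ 3) *\<^sub>R (p 1 - p 0) + (m 0 * m 2 / cmod (p 0 - p 2) ^ 3) *\<^sub>R (p 2 - p 0)"
  "force m p 1 = (m 1 * m 2 / cmod (p 1 - p 2) ^ 3) *\<^sub>R (p 2 - p 1) + (m 1 * m 0 / cmod (p 1 - p 0) ^ 3) *\<^sub>R (p 0 - p 1)"
  "force m p 2 = (m 2 * m 0 / cmod (p 2 - p 0) ^ 3) *\<^sub>R (p 0 - p 2) + (m 2 * m 1 / cmod (p 2 - p 1) ^ 3) *\<^sub>R (p 1 - p 2)"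
proof -
  have "{..<3} - {0} = {1, 2::nat}" "{..<3} - {1} = {2, 0::nat}" "{..<3} - {2} = {0, 1::nat}"
    by auto
  then show
    "force m p 0 = (m 0 * m 1 / cmod (p 0 - p 1) ^ 3) *\<^sub>R (p 1 - p 0) + (m 0 * m 2 / cmod (p 0 - p 2) ^ 3) *\<^sub>R (p 2 - p 0)"
    "force m p 1 = (m 1 * m 2 / cmod (p 1 - p 2) ^ 3) *\<^sub>R (p 2 - p 1) + (m 1 * m 0 / cmod (p 1 - p 0) ^ 3) *\<^sub>R (p 0 - p 1)"
    "force m p 2 = (m 2 * m 0 / cmod (p 2 - p 0) ^ 3) *\<^sub>R (p 0 - p 2) + (m 2 * m 1 / cmod (p 2 - p 1) ^ 3) *\<^sub>R (p 1 - p 2)"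
    unfolding force_def by (simp_all add: scaleR_conv_of_real)
qed

text \<open>The opposite vectors c z and a x + b y have the same squared length. This is the law of
  cosines for a triangle with sides a x, b y, c z, and it makes inner products functions of the
  moments.\<close>

lemma inner_barycentric:
  fixes x y z :: "'a::real_inner"
  assumes "a *\<^sub>R x + b *\<^sub>R y + c *\<^sub>R z = 0"
  shows "2 * (a * b) * inner x y = c\<^sup>2 * (norm z)\<^sup>2 - a\<^sup>2 * (norm x)\<^sup>2 - b\<^sup>2 * (norm y)\<^sup>2"
proof -
  have z: "c *\<^sub>R z = - (a *\<^sub>R x + b *\<^sub>R y)"
    using assms by (simp only: eq_neg_iff_add_eq_0 add.commute)
  have "inner (c *\<^sub>R z) (c *\<^sub>R z) = inner (a *\<^sub>R x + b *\<^sub>R y) (a *\<^sub>R x + b *\<^sub>R y)"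
    unfolding z by (simp only: inner_minus_left inner_minus_right minus_minus)
  then show ?thesis
    unfolding power2_norm_eq_inner
    by (simp add: inner_add_left inner_add_right inner_commute[of y x] power2_eq_square algebra_simps)
qed

text \<open>The same comparison, polarized: c z is paired with c w instead of with itself. With u,
  v, w as velocities it yields the rate of the inner product of x and y.\<close>

lemma inner_barycentric_rate:
  fixes x y z :: "'a::real_inner"
  assumes "a *\<^sub>R x + b *\<^sub>R y + c *\<^sub>R z = 0" "a *\<^sub>R u + b *\<^sub>R v + c *\<^sub>R w = 0"
  shows "(a * b) * (inner x v + inner y u) = c\<^sup>2 * inner z w - a\<^sup>2 * inner x u - b\<^sup>2 * inner y v"
proof -
  have z: "c *\<^sub>R z = - (a *\<^sub>R x + b *\<^sub>R y)" "c *\<^sub>R w = - (a *\<^sub>R u + b *\<^sub>R v)"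
    using assms by (simp_all only: eq_neg_iff_add_eq_0 add.commute)
  have "inner (c *\<^sub>R z) (c *\<^sub>R w) = inner (a *\<^sub>R x + b *\<^sub>R y) (a *\<^sub>R u + b *\<^sub>R v)"
    unfolding z by (simp only: inner_minus_left inner_minus_right minus_minus)
  then show ?thesis
    by (simp add: inner_add_left inner_add_right power2_eq_square algebra_simps)
qed

text \<open>Expanding the square leaves one unknown, the inner product of x and y, which the law of
  cosines supplies. With c = 1 - a - b this is the distance formula behind
  \<open>rsq\<close>.\<close>

lemma dist_barycentric:
  fixes x y z :: "'a::real_inner"
  assumes "a *\<^sub>R x + b *\<^sub>R y + c *\<^sub>R z = 0" "a + b + c = 1"
  shows "a * b * (norm (x - y))\<^sup>2 =
    (1 - c) * (a * (norm x)\<^sup>2 + b * (norm y)\<^sup>2 + c * (norm z)\<^sup>2) - c * (norm z)\<^sup>2"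
proof -
  have c: "c = 1 - a - b" using assms by simp
  have "a * b * (norm (x - y))\<^sup>2 = a * b * (norm x)\<^sup>2 + a * b * (norm y)\<^sup>2 - 2 * (a * b) * inner x y"
    by (simp add: power2_norm_eq_inner inner_diff_left inner_diff_right inner_commute[of y x] algebra_simps)
  then show ?thesis
    unfolding inner_barycentric[OF assms(1)] unfolding c by (simp add: algebra_simps power2_eq_square)
qed

lemma cross2_simps:
  "cross2 x y = Re x * Im y - Im x * Re y"
  by (simp add: cross2_def algebra_simps)

text \<open>Taking the cross product of the relation with y, and then with x, eliminates one vector
  each time.\<close>

lemma cross2_barycentric:
  assumes "a *\<^sub>R x + b *\<^sub>R y + c *\<^sub>R z = 0"
  shows "b * c * cross2 y z = a * b * cross2 x y" "c * a * cross2 z x = a * b * cross2 x y"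
proof -
  have z: "c * Re z = - (a * Re x + b * Re y)" "c * Im z = - (a * Im x + b * Im y)"
    using assms by (auto simp: complex_eq_iff)
  have "b * c * cross2 y z = b * (Re y * (c * Im z) - Im y * (c * Re z))"
    by (simp add: cross2_simps algebra_simps)
  then show "b * c * cross2 y z = a * b * cross2 x y"
    unfolding z by (simp add: cross2_simps algebra_simps)
  have "c * a * cross2 z x = a * ((c * Re z) * Im x - (c * Im z) * Re x)"
    by (simp add: cross2_simps algebra_simps)
  then show "c * a * cross2 z x = a * b * cross2 x y"
    unfolding z by (simp add: cross2_simps algebra_simps)
qed

text \<open>A planar Binet-Cauchy identity. Divided by the squared length of x, it trades the
  angular velocity of x for inner products.\<close>

lemma cross2_mult_cross2:
  "cross2 x y * cross2 x v = (cmod x)\<^sup>2 * inner y v - inner x y * inner x v"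
  unfolding cross2_simps cmod_power2 inner_complex_def
  by (simp add: algebra_simps power2_eq_square)

lemma cross2_commute: "cross2 y x = - cross2 x y"
  by (simp add: cross2_simps)

lemma norm_cross_inner: "(inner x v)\<^sup>2 + (cross2 x v)\<^sup>2 = (cmod x)\<^sup>2 * (cmod v)\<^sup>2"
  unfolding cross2_simps cmod_power2 inner_complex_def
  by (simp add: algebra_simps power2_eq_square)

section \<open>Geometry and kinematics of a single configuration\<close>

locale centred_triangle =
  fixes m :: "nat \<Rightarrow> real" and p :: "nat \<Rightarrow> complex"
  assumes masses: "masses_ok m"
    and centre: "(\<Sum>i<3. complex_of_real (m i) * p i) = 0"
begin

lemma mass_pos: "m 0 > 0" "m 1 > 0" "m 2 > 0" and mass_sum: "m 0 + m 1 + m 2 = 1"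
  using masses by (auto simp: masses_ok_def all_less_3)

lemma centre_cyclic:
  "m 0 *\<^sub>R p 0 + m 1 *\<^sub>R p 1 + m 2 *\<^sub>R p 2 = 0"
  "m 1 *\<^sub>R p 1 + m 2 *\<^sub>R p 2 + m 0 *\<^sub>R p 0 = 0"
  "m 2 *\<^sub>R p 2 + m 0 *\<^sub>R p 0 + m 1 *\<^sub>R p 1 = 0"
  using centre by (simp_all add: sum_less_3 scaleR_conv_of_real algebra_simps)

text \<open>Twice the area is the sum of the three cross products. Multiplied by the product of the
  masses, each summand becomes a mass times the same value \<open>?D\<close>, and the masses add up
  to 1.\<close>

lemma cross2_signed_area:
  "m 0 * m 1 * cross2 (p 0) (p 1) = 2 * (m 0 * m 1 * m 2) * signed_area p"
  "m 1 * m 2 * cross2 (p 1) (p 2) = 2 * (m 0 * m 1 * m 2) * signed_area p"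
  "m 2 * m 0 * cross2 (p 2) (p 0) = 2 * (m 0 * m 1 * m 2) * signed_area p"
proof -
  note c = cross2_barycentric[OF centre_cyclic(1)]
  let ?D = "m 0 * m 1 * cross2 (p 0) (p 1)"
  have "2 * signed_area p = cross2 (p 0) (p 1) + cross2 (p 1) (p 2) + cross2 (p 2) (p 0)"
    by (simp add: signed_area_def cross2_simps field_simps)
  then have "2 * (m 0 * m 1 * m 2) * signed_area p =
      m 2 * ?D + m 0 * (m 1 * m 2 * cross2 (p 1) (p 2)) + m 1 * (m 2 * m 0 * cross2 (p 2) (p 0))"
    by algebra
  also have "\<dots> = (m 0 + m 1 + m 2) * ?D"
    unfolding c by (simp add: algebra_simps)
  finally show *: "?D = 2 * (m 0 * m 1 * m 2) * signed_area p"
    unfolding mass_sum by (simp only: mult_1)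
  show "m 1 * m 2 * cross2 (p 1) (p 2) = 2 * (m 0 * m 1 * m 2) * signed_area p"
    "m 2 * m 0 * cross2 (p 2) (p 0) = 2 * (m 0 * m 1 * m 2) * signed_area p"
    unfolding c * by (rule refl)+
qed

lemma rsq_moments:
  assumes "i < 3" "j < 3" "i \<noteq> j"
  shows "rsq m (moments m p) i j = (cmod (p i - p j))\<^sup>2"
proof -
  note d = dist_barycentric[OF centre_cyclic(1)] dist_barycentric[OF centre_cyclic(2)]
      dist_barycentric[OF centre_cyclic(3)]
  have "rsq m (moments m p) 0 1 = (cmod (p 0 - p 1))\<^sup>2" "rsq m (moments m p) 1 2 = (cmod (p 1 - p 2))\<^sup>2"
    "rsq m (moments m p) 2 0 = (cmod (p 2 - p 0))\<^sup>2"
    using d mass_sum mass_pos by (simp_all add: rsq_def Itot_def divide_simps algebra_simps)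
  moreover have "rsq m (moments m p) i j = rsq m (moments m p) j i"
    by (simp add: rsq_def mult.commute diff_diff_add add.commute)
  ultimately show ?thesis
    using less_3_cases[OF assms(1)] less_3_cases[OF assms(2)] assms(3)
    by (auto simp: norm_minus_commute)
qed

lemma rdist_moments:
  assumes "i < 3" "j < 3" "i \<noteq> j"
  shows "rdist m (moments m p) i j = cmod (p i - p j)"
  by (simp add: rdist_def rsq_moments[OF assms])

lemma heron16_moments: "heron16 m (moments m p) = 16 * (signed_area p)\<^sup>2"
proof -
  define x y z where "x = (cmod (p 0 - p 1))\<^sup>2" and "y = (cmod (p 1 - p 2))\<^sup>2" and "z = (cmod (p 0 - p 2))\<^sup>2"
  note xyz = this
  have "2 * (x * y + y * z + z * x) - (x\<^sup>2 + y\<^sup>2 + z\<^sup>2) = 4 * (cross2 (p 1 - p 0) (p 2 - p 0))\<^sup>2"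
    unfolding xyz cmod_power2 cross2_simps minus_complex.sel by algebra
  moreover have "rsq m (moments m p) 0 1 = x" "rsq m (moments m p) 1 2 = y" "rsq m (moments m p) 0 2 = z"
    using rsq_moments[of 0 1] rsq_moments[of 1 2] rsq_moments[of 0 2] by (simp_all add: xyz)
  ultimately show ?thesis
    by (simp add: heron16_def signed_area_def power_divide)
qed

text \<open>The sign restores the orientation that Heron's square root loses, which is why the
  reduced equation is always read with \<open>eps\<close> equal to the sign of the area.\<close>

lemma Delta_mod_moments: "Delta_mod m (sgn (signed_area p)) (moments m p) = signed_area p"
  by (simp add: Delta_mod_def heron16_moments real_sqrt_mult sgn_mult_abs)

lemma noncollinear_nonzero:
  assumes "signed_area p \<noteq> 0" "i < 3"
  shows "p i \<noteq> 0"
  using less_3_cases[OF assms(2)] cross2_signed_area mass_pos assms(1) by (auto simp: cross2_simps)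

lemma noncollinear_distinct:
  assumes "signed_area p \<noteq> 0" "i < 3" "j < 3" "i \<noteq> j"
  shows "p i \<noteq> p j"
proof
  assume "p i = p j"
  then have "signed_area p = 0"
    using less_3_cases[OF assms(2)] less_3_cases[OF assms(3)] assms(4)
    by (auto simp: signed_area_def cross2_simps)
  then show False using assms(1) by simp
qed

text \<open>Two different points cannot both be the origin. Stated this way, the result covers
  collinear configurations, through which a motion may pass.\<close>

lemma Itot_pos:
  assumes "p 0 \<noteq> p 1"
  shows "Itot (moments m p) > 0"
proof -
  have "cmod (p 0) > 0 \<or> cmod (p 1) > 0" using assms by auto
  then have "m 0 * (cmod (p 0))\<^sup>2 > 0 \<or> m 1 * (cmod (p 1))\<^sup>2 > 0"
    using mass_pos by auto
  moreover have "m 0 * (cmod (p 0))\<^sup>2 \<ge> 0" "m 1 * (cmod (p 1))\<^sup>2 \<ge> 0" "m 2 * (cmod (p 2))\<^sup>2 \<ge> 0"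
    using mass_pos by auto
  ultimately show ?thesis unfolding Itot_def by linarith
qed

text \<open>The law of cosines replaces 2 m_i m_j (p_i . p_j) by m_k I_k - m_i I_i - m_j I_j, and
  subtracting 2 m_j I_i produces the coefficient m_i + 2 m_j. The result is the potential part of
  the reduced equation.\<close>

lemma inner_force:
  assumes "i < 3" and j: "j = (i + 1) mod 3" and k: "k = (i + 2) mod 3"
  shows "2 * inner (p i) (force m p i) =
    - ((m i + 2 * m j) / cmod (p i - p j) ^ 3 + (m i + 2 * m k) / cmod (p i - p k) ^ 3) * moments m p i
    - (1 / cmod (p i - p j) ^ 3 - 1 / cmod (p i - p k) ^ 3) * (m j * moments m p j - m k * moments m p k)"
proof -
  have ijk: "i = 0 \<and> j = 1 \<and> k = 2 \<or> i = 1 \<and> j = 2 \<and> k = 0 \<or> i = 2 \<and> j = 0 \<and> k = 1"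
    using less_3_cases[OF \<open>i < 3\<close>] j k by auto
  have jk: "m i *\<^sub>R p i + m j *\<^sub>R p j + m k *\<^sub>R p k = 0"
    using ijk centre_cyclic by auto
  then have kj: "m i *\<^sub>R p i + m k *\<^sub>R p k + m j *\<^sub>R p j = 0" by (simp add: algebra_simps)
  define R S where "R = 1 / cmod (p i - p j) ^ 3" and "S = 1 / cmod (p i - p k) ^ 3"
  have "force m p i = (m i * m j * R) *\<^sub>R (p j - p i) + (m i * m k * S) *\<^sub>R (p k - p i)"
    using ijk force_expand[of m p] by (elim disjE) (simp_all add: R_def S_def)
  then have f: "2 * inner (p i) (force m p i) =
      2 * inner (p i) ((m i * m j * R) *\<^sub>R (p j - p i) + (m i * m k * S) *\<^sub>R (p k - p i))"
    by simp
  have "2 * inner (p i) (force m p i) =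
     R * (2 * (m i * m j) * inner (p i) (p j) - 2 * m i * m j * (cmod (p i))\<^sup>2)
     + S * (2 * (m i * m k) * inner (p i) (p k) - 2 * m i * m k * (cmod (p i))\<^sup>2)"
    unfolding f by (simp add: inner_add_right inner_diff_right power2_norm_eq_inner algebra_simps)
  also have "\<dots> = - ((m i + 2 * m j) * R + (m i + 2 * m k) * S) * moments m p i
    - (R - S) * (m j * moments m p j - m k * moments m p k)"
    unfolding inner_barycentric[OF jk] inner_barycentric[OF kj]
    by (simp add: algebra_simps power2_eq_square)
  finally show ?thesis by (simp add: R_def S_def)
qed

text \<open>The angular momentum \<open>L\<close> is the sum of all I_l w_l, so I w_i - L is the
  combination I_j (w_i - w_j) + I_k (w_i - w_k) of relative angular velocities. Written in the
  moments and their rates, it is I times \<open>omega0\<close>.\<close>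

lemma omega_mod_moments:
  assumes velocity: "(\<Sum>i<3. complex_of_real (m i) * v i) = 0"
    and nc: "signed_area p \<noteq> 0" and "i < 3"
  shows "omega_mod m (\<Sum>i<3. m i * cross2 (p i) (v i)) (sgn (signed_area p))
      (moments m p) (moment_rates m p v) i = cross2 (p i) (v i) / (cmod (p i))\<^sup>2"
proof -
  define j k where j: "j = (i + 1) mod 3" and k: "k = (i + 2) mod 3"
  define I I' where I: "I = moments m p" and I': "I' = moment_rates m p v"
  define L where "L = (\<Sum>i<3. m i * cross2 (p i) (v i))"
  define D where "D = 2 * (m 0 * m 1 * m 2) * signed_area p"
  have ijk: "i = 0 \<and> j = 1 \<and> k = 2 \<or> i = 1 \<and> j = 2 \<and> k = 0 \<or> i = 2 \<and> j = 0 \<and> k = 1"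
    using less_3_cases[OF \<open>i < 3\<close>] j k by auto
  have lt: "i < 3" "j < 3" "k < 3" using ijk by auto
  have mpos: "m i > 0" "m j > 0" "m k > 0" using ijk mass_pos by auto
  have D0: "D \<noteq> 0" using nc mass_pos by (simp add: D_def)
  have nz: "cmod (p i) \<noteq> 0" "cmod (p j) \<noteq> 0" "cmod (p k) \<noteq> 0"
    using lt noncollinear_nonzero[OF nc] by auto
  have Ipos: "I i > 0" "I j > 0" "I k > 0" using mpos nz by (simp_all add: I)
  have It: "Itot I = I i + I j + I k" using ijk by (auto simp: Itot_def)
  have Itpos: "Itot I > 0" using Ipos It by simp
  have p: "m i *\<^sub>R p i + m j *\<^sub>R p j + m k *\<^sub>R p k = 0"
    using ijk centre_cyclic by auto
  have v: "m i *\<^sub>R v i + m j *\<^sub>R v j + m k *\<^sub>R v k = 0"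
    using ijk velocity by (auto simp: sum_less_3 scaleR_conv_of_real algebra_simps)
  have p': "m i *\<^sub>R p i + m k *\<^sub>R p k + m j *\<^sub>R p j = 0"
    and v': "m i *\<^sub>R v i + m k *\<^sub>R v k + m j *\<^sub>R v j = 0"
    using p v by (simp_all add: algebra_simps)
  have L: "L = m i * cross2 (p i) (v i) + m j * cross2 (p j) (v j) + m k * cross2 (p k) (v k)"
    using ijk by (auto simp: L_def sum_less_3)
  have "m i * m j * cross2 (p i) (p j) = D" "m k * m i * cross2 (p k) (p i) = D"
    unfolding D_def using ijk cross2_signed_area by (elim disjE conjE; simp only:)+
  then have Dij: "D = m i * m j * cross2 (p i) (p j)" "D = - (m i * m k * cross2 (p i) (p k))"
    by (simp_all add: cross2_commute[of "p i" "p k"] mult.commute)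
  define w where "w = (\<lambda>i. cross2 (p i) (v i) / (cmod (p i))\<^sup>2)"
  have Iw: "I l * w l = m l * cross2 (p l) (v l)" if "cmod (p l) \<noteq> 0" for l
    using that by (simp add: I w_def)
  \<comment> \<open>the relative angular velocity of two bodies is the rate of their central angle,
    a function of the moments only\<close>
  have rel: "4 * (m x * m y * cross2 (p x) (p y)) * (w x - w y) =
      2 * (m z * I' z - m x * I' x - m y * I' y)
      - (m z * I z - m x * I x - m y * I y) * (I' x / I x + I' y / I y)"
    if xy: "m x *\<^sub>R p x + m y *\<^sub>R p y + m z *\<^sub>R p z = 0" "m x *\<^sub>R v x + m y *\<^sub>R v y + m z *\<^sub>R v z = 0"
      and nx: "cmod (p x) \<noteq> 0" "cmod (p y) \<noteq> 0" "m x > 0" "m y > 0" for x y z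
  proof -
    \<comment> \<open>In \<open>a\<close> and \<open>b\<close> Binet-Cauchy removes the angular
      velocities. The mixed inner products left over are exactly the two that \<open>e\<close>
      evaluates together.\<close>
    have a: "cross2 (p x) (p y) * w x = inner (p y) (v x) - inner (p x) (p y) * (inner (p x) (v x) / (cmod (p x))\<^sup>2)"
      using nx cross2_mult_cross2[of "p x" "p y" "v x"] by (simp add: w_def field_simps)
    have b: "cross2 (p x) (p y) * w y = - inner (p x) (v y) + inner (p x) (p y) * (inner (p y) (v y) / (cmod (p y))\<^sup>2)"
      using nx cross2_mult_cross2[of "p y" "p x" "v y"] cross2_commute[of "p x" "p y"]
      by (simp add: w_def field_simps inner_commute)
    have c: "I' x / I x = 2 * (inner (p x) (v x) / (cmod (p x))\<^sup>2)" "I' y / I y = 2 * (inner (p y) (v y) / (cmod (p y))\<^sup>2)"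
      using nx by (simp_all add: I I')
    have d: "2 * (m x * m y) * inner (p x) (p y) = m z * I z - m x * I x - m y * I y"
      using inner_barycentric[OF xy(1)] by (simp add: I power2_eq_square algebra_simps)
    have e: "2 * (m x * m y) * (inner (p x) (v y) + inner (p y) (v x)) = m z * I' z - m x * I' x - m y * I' y"
      using inner_barycentric_rate[OF xy] by (simp add: I' power2_eq_square algebra_simps)
    have "4 * (m x * m y * cross2 (p x) (p y)) * (w x - w y)
      = 4 * m x * m y * (cross2 (p x) (p y) * w x - cross2 (p x) (p y) * w y)"
      by (simp add: algebra_simps)
    also have "\<dots> = 2 * (2 * (m x * m y) * (inner (p x) (v y) + inner (p y) (v x)))
       - (2 * (m x * m y) * inner (p x) (p y)) * (I' x / I x + I' y / I y)"
      unfolding a b c by (simp add: algebra_simps)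
    finally show ?thesis unfolding d e .
  qed
  have r1: "4 * D * (w i - w j) = 2 * (m k * I' k - m i * I' i - m j * I' j)
      - (m k * I k - m i * I i - m j * I j) * (I' i / I i + I' j / I j)"
    using rel[OF p v] nz mpos Dij(1) by simp
  have r2: "4 * D * (w i - w k) = - (2 * (m j * I' j - m i * I' i - m k * I' k)
      - (m j * I j - m i * I i - m k * I k) * (I' i / I i + I' k / I k))"
    using rel[OF p' v'] nz mpos unfolding Dij(2) by simp
  \<comment> \<open>In the target formula only the rate of I_i is divided by a moment. The other two
    quotients cancel, being multiplied by I_j and I_k in \<open>e1\<close> and
    \<open>e2\<close>.\<close>
  define A where "A = I' i / I i"
  have q: "I' i = A * I i" using Ipos by (simp add: A_def)
  have e1: "I j * (I' i / I i + I' j / I j) = I j * A + I' j" using Ipos by (simp add: A_def algebra_simps)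
  have e2: "I k * (I' i / I i + I' k / I k) = I k * A + I' k" using Ipos by (simp add: A_def algebra_simps)
  have "4 * D * (Itot I * w i - L) = I j * (4 * D * (w i - w j)) + I k * (4 * D * (w i - w k))"
    unfolding L It Iw[OF nz(1), symmetric] Iw[OF nz(2), symmetric] Iw[OF nz(3), symmetric]
    by (simp add: algebra_simps)
  also have "\<dots> = 2 * I j * (m k * I' k - m i * I' i - m j * I' j)
      - (m k * I k - m i * I i - m j * I j) * (I j * (I' i / I i + I' j / I j))
      - 2 * I k * (m j * I' j - m i * I' i - m k * I' k)
      + (m j * I j - m i * I i - m k * I k) * (I k * (I' i / I i + I' k / I k))"
    unfolding r1 r2 by (simp add: algebra_simps)
  also have "\<dots> = (Ccoef m I k * I k - Ccoef m I j * I j) * A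
         - (Ccoef m I i + 2 * m j * I k) * I' j + (Ccoef m I i + 2 * m k * I j) * I' k"
    unfolding e1 e2 unfolding q Ccoef_def using ijk
    by (elim disjE) (simp_all add: algebra_simps numeral_2_eq_2)
  finally have key: "4 * D * (Itot I * w i - L) = (Ccoef m I k * I k - Ccoef m I j * I j) * A
         - (Ccoef m I i + 2 * m j * I k) * I' j + (Ccoef m I i + 2 * m k * I j) * I' k" .
  \<comment> \<open>The 8 in \<open>omega0\<close> is the 4 from the relative angular velocities
    times the 2 inside \<open>D\<close>.\<close>
  have Dm: "8 * m i * m j * m k * Delta_mod m (sgn (signed_area p)) I = 4 * D"
    using ijk unfolding I Delta_mod_moments D_def by auto
  have "omega0 m (sgn (signed_area p)) I I' i = 1 / (4 * D * Itot I) * (4 * D * (Itot I * w i - L))"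
    unfolding omega0_def Let_def j[symmetric] k[symmetric] Dm key A_def by simp
  also have "\<dots> = (Itot I * w i - L) / Itot I"
    using D0 by simp
  finally have "omega_mod m L (sgn (signed_area p)) I I' i = w i"
    using Itpos by (simp add: omega_mod_def field_simps)
  then show ?thesis by (simp add: L_def w_def I I')
qed

text \<open>The radial and the angular part of \<open>Tkin\<close> add up to m_i |v_i|^2 / 2, and
  \<open>inner_force\<close> recognizes the remaining terms. Angular velocities and orientation drop
  out of the equation.\<close>

lemma reduced_newton_iff:
  assumes velocity: "(\<Sum>i<3. complex_of_real (m i) * v i) = 0" and nc: "signed_area p \<noteq> 0"
  shows "reduced_newton m (\<Sum>i<3. m i * cross2 (p i) (v i)) (sgn (signed_area p))
      (moments m p) (moment_rates m p v) I'' \<longleftrightarrow>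
    (\<forall>i<3. I'' i = 2 * m i * (cmod (v i))\<^sup>2 + 2 * inner (p i) (force m p i))"
  unfolding reduced_newton_def Let_def
proof (intro all_cong1 imp_cong refl)
  fix i :: nat
  assume i: "i < 3"
  define j k where j: "j = (i + 1) mod 3" and k: "k = (i + 2) mod 3"
  have ijk: "i < 3" "j < 3" "i \<noteq> j" "k < 3" "i \<noteq> k"
    using less_3_cases[OF i] j k by auto
  have mi: "m i > 0" using i mass_pos less_3_cases[OF i] by auto
  have "4 * Tkin m (\<Sum>i<3. m i * cross2 (p i) (v i)) (sgn (signed_area p)) (moments m p) (moment_rates m p v) i
      = 2 * m i * ((inner (p i) (v i))\<^sup>2 + (cross2 (p i) (v i))\<^sup>2) / (cmod (p i))\<^sup>2"
    unfolding Tkin_def omega_mod_moments[OF velocity nc i]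
    using noncollinear_nonzero[OF nc i] mi by (simp add: field_simps power2_eq_square)
  also have "\<dots> = 2 * m i * (cmod (v i))\<^sup>2"
    unfolding norm_cross_inner using noncollinear_nonzero[OF nc i] by simp
  finally show "(I'' i = 4 * Tkin m (\<Sum>i<3. m i * cross2 (p i) (v i)) (sgn (signed_area p)) (moments m p) (moment_rates m p v) i -
           ((m i + 2 * m ((i + 1) mod 3)) / rdist m (moments m p) i ((i + 1) mod 3) ^ 3 +
            (m i + 2 * m ((i + 2) mod 3)) / rdist m (moments m p) i ((i + 2) mod 3) ^ 3) * moments m p i -
           (1 / rdist m (moments m p) i ((i + 1) mod 3) ^ 3 - 1 / rdist m (moments m p) i ((i + 2) mod 3) ^ 3) *
           (m ((i + 1) mod 3) * moments m p ((i + 1) mod 3) - m ((i + 2) mod 3) * moments m p ((i + 2) mod 3)))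
      \<longleftrightarrow> (I'' i = 2 * m i * (cmod (v i))\<^sup>2 + 2 * inner (p i) (force m p i))"
    unfolding j[symmetric] k[symmetric] inner_force[OF i j k]
      rdist_moments[OF ijk(1,2,3)] rdist_moments[OF ijk(1,4,5)]
    by (simp only: diff_conv_add_uminus mult_minus_left add.assoc)
qed

end

section \<open>Dependence of the reduced quantities on the indices 0, 1, 2 alone\<close>

lemma omega_mod_cong:
  assumes "\<And>i. i < 3 \<Longrightarrow> I i = K i" "\<And>i. i < 3 \<Longrightarrow> I' i = K' i" "i < 3"
  shows "omega_mod m \<Omega> eps I I' i = omega_mod m \<Omega> eps K K' i"
proof -
  \<comment> \<open>Index 2 is listed a second time in the successor form in which simplification
    may leave it.\<close>
  have "I 0 = K 0" "I 1 = K 1" "I 2 = K 2" "I (Suc (Suc 0)) = K (Suc (Suc 0))"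
    "I' 0 = K' 0" "I' 1 = K' 1" "I' 2 = K' 2" "I' (Suc (Suc 0)) = K' (Suc (Suc 0))"
    using assms by simp_all
  then show ?thesis
    using less_3_cases[OF assms(3)]
    unfolding omega_mod_def omega0_def Let_def Delta_mod_def heron16_def rsq_def Itot_def Ccoef_def
    by (elim disjE) simp_all
qed

lemma rdist_cong:
  assumes "\<And>i. i < 3 \<Longrightarrow> I i = K i" "j < 3" "k < 3" "j \<noteq> k"
  shows "rdist m I j k = rdist m K j k"
proof -
  have "I 0 = K 0" "I 1 = K 1" "I 2 = K 2" "3 - j - k < 3"
    using assms by auto
  then show ?thesis
    unfolding rdist_def rsq_def Itot_def by (simp add: assms(1))
qed

text \<open>Needed because a moduli curve and the moments of a motion agree only at indices below 3,
  so they cannot be exchanged as functions.\<close>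

lemma reduced_newton_cong:
  assumes "\<And>i. i < 3 \<Longrightarrow> I i = K i" "\<And>i. i < 3 \<Longrightarrow> I' i = K' i" "\<And>i. i < 3 \<Longrightarrow> I'' i = K'' i"
  shows "reduced_newton m \<Omega> eps I I' I'' \<longleftrightarrow> reduced_newton m \<Omega> eps K K' K''"
proof -
  have "rdist m I i ((i + 1) mod 3) = rdist m K i ((i + 1) mod 3)"
    "rdist m I i ((i + 2) mod 3) = rdist m K i ((i + 2) mod 3)" if "i < 3" for i
    using rdist_cong[of I K, OF assms(1)] less_3_cases[OF that] by auto
  moreover have "omega_mod m \<Omega> eps I I' i = omega_mod m \<Omega> eps K K' i" if "i < 3" for i
    by (rule omega_mod_cong) (use assms that in auto)
  ultimately show ?thesis
    unfolding reduced_newton_def Let_def Tkin_def using assms by simp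
qed

section \<open>Internal forces, and forces orthogonal to the positions\<close>

lemma sum_force: "(\<Sum>i<3. force m p i) = 0"
  unfolding sum_less_3 force_expand
  by (simp add: norm_minus_commute mult.commute complex_eq_iff algebra_simps)

text \<open>Each pair of opposite forces acts along the line joining its two bodies.\<close>

lemma torque_force: "(\<Sum>i<3. cross2 (p i) (force m p i)) = 0"
  unfolding sum_less_3 force_expand
  by (simp add: norm_minus_commute mult.commute cross2_simps algebra_simps)

context centred_triangle
begin

text \<open>Orthogonality makes e_i a real multiple l_i of p_i turned by a right angle, so the zero
  sum is a linear relation among the p_i. In a noncollinear triangle every such relation is a
  multiple of the centre relation, hence l_i = c m_i, and the torque becomes c times the total
  moment.\<close>

lemma residual_force_eq_0:
  assumes nc: "signed_area p \<noteq> 0" and sum: "(\<Sum>i<3. e i) = 0"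
    and perp: "\<And>i. i < 3 \<Longrightarrow> inner (p i) (e i) = 0"
    and torque: "(\<Sum>i<3. cross2 (p i) (e i)) = 0" and "i < 3"
  shows "e i = 0"
proof -
  define l where "l = (\<lambda>i. cross2 (p i) (e i) / (cmod (p i))\<^sup>2)"
  have nz: "(cmod (p i))\<^sup>2 > 0" if "i < 3" for i
    using noncollinear_nonzero[OF nc that] by simp
  have ll: "l i * (cmod (p i))\<^sup>2 = cross2 (p i) (e i)" if "i < 3" for i
    using nz[OF that] by (simp add: l_def)
  have e: "e i = \<i> * (l i *\<^sub>R p i)" if "i < 3" for i
  proof -
    have "(cmod (p i))\<^sup>2 *\<^sub>R e i = inner (p i) (e i) *\<^sub>R p i + \<i> * (cross2 (p i) (e i) *\<^sub>R p i)"
      unfolding cmod_power2 complex_eq_iff inner_complex_def cross2_simps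
      by (simp add: power2_eq_square algebra_simps)
    also have "\<dots> = (cmod (p i))\<^sup>2 *\<^sub>R (\<i> * (l i *\<^sub>R p i))"
      using perp[OF that] ll[OF that] by (simp add: mult.commute)
    finally have "(cmod (p i))\<^sup>2 *\<^sub>R e i = (cmod (p i))\<^sup>2 *\<^sub>R (\<i> * (l i *\<^sub>R p i))" .
    then show ?thesis by (rule scaleR_left_imp_eq[rotated]) (use nz[OF that] in simp)
  qed
  have "\<i> * (l 0 *\<^sub>R p 0 + l 1 *\<^sub>R p 1 + l 2 *\<^sub>R p 2) = 0"
    using sum e[of 0] e[of 1] e[of 2] by (simp add: sum_less_3 algebra_simps)
  then have l0: "l 0 *\<^sub>R p 0 + l 1 *\<^sub>R p 1 + l 2 *\<^sub>R p 2 = 0" by simp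
  have proportional: "m j * l i = m i * l j"
    if D: "m i * m k * cross2 (p i) (p k) = - D" "m j * m k * cross2 (p j) (p k) = D" "D \<noteq> 0"
      and "l i *\<^sub>R p i + l j *\<^sub>R p j + l k *\<^sub>R p k = 0" for i j k D
  proof -
    \<comment> \<open>The cross product with p_k removes l_k from the relation.\<close>
    have "cross2 (l i *\<^sub>R p i + l j *\<^sub>R p j + l k *\<^sub>R p k) (p k) = 0"
      unfolding that(4) by (simp add: cross2_simps)
    then have "l i * cross2 (p i) (p k) + l j * cross2 (p j) (p k) = 0"
      by (simp add: cross2_simps algebra_simps)
    then have "m j * l i * (m i * m k * cross2 (p i) (p k)) + m i * l j * (m j * m k * cross2 (p j) (p k)) = 0"
      by algebra
    then have "D * (m j * l i - m i * l j) = 0" unfolding D(1,2) by algebra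
    then show ?thesis using D(3) by simp
  qed
  let ?D = "2 * (m 0 * m 1 * m 2) * signed_area p"
  have D0: "?D \<noteq> 0" using nc mass_pos by simp
  have c: "m 0 * m 2 * cross2 (p 0) (p 2) = - ?D" "m 1 * m 2 * cross2 (p 1) (p 2) = ?D"
     "m 1 * m 0 * cross2 (p 1) (p 0) = - ?D" "m 2 * m 0 * cross2 (p 2) (p 0) = ?D"
    using cross2_signed_area cross2_commute[of "p 0" "p 2"] cross2_commute[of "p 0" "p 1"]
    by algebra+
  have p1: "m 1 * l 0 = m 0 * l 1" by (rule proportional[OF c(1,2) D0 l0])
  have p2: "m 2 * l 1 = m 1 * l 2" by (rule proportional[OF c(3,4) D0]) (use l0 in \<open>simp add: algebra_simps\<close>)
  have "l 0 * (cmod (p 0))\<^sup>2 + l 1 * (cmod (p 1))\<^sup>2 + l 2 * (cmod (p 2))\<^sup>2 = 0"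
    using torque ll[of 0] ll[of 1] ll[of 2] by (simp add: sum_less_3)
  then have "l 1 * Itot (moments m p) = 0"
    using p1 p2 unfolding Itot_def by algebra
  then have l1: "l 1 = 0"
    using Itot_pos noncollinear_distinct[OF nc, of 0 1] by simp
  then have "l 0 = 0" "l 2 = 0" using p1 p2 mass_pos by simp_all
  then have "l i = 0" using l1 less_3_cases[OF \<open>i < 3\<close>] by auto
  then show ?thesis using e[OF \<open>i < 3\<close>] by simp
qed

end

subsection \<open>Moments along a motion\<close>

text \<open>Velocities and accelerations are parameters so that the locale serves both a given
  motion, with \<open>vector_derivative\<close>, and the constructed one, with chosen derivatives.
  Newton's equation is left out, since the construction has to derive it inside the locale.\<close>

locale kinematics =
  fixes m :: "nat \<Rightarrow> real" and a v w :: "nat \<Rightarrow> real \<Rightarrow> complex" and J :: "real set"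
  assumes masses: "masses_ok m" and open_J: "open J"
    and centre: "\<And>t. t \<in> J \<Longrightarrow> (\<Sum>i<3. complex_of_real (m i) * a i t) = 0"
    and velocity: "\<And>i t. i < 3 \<Longrightarrow> t \<in> J \<Longrightarrow> (a i has_vector_derivative v i t) (at t)"
    and acceleration: "\<And>i t. i < 3 \<Longrightarrow> t \<in> J \<Longrightarrow> (v i has_vector_derivative w i t) (at t)"
begin

lemma vector_derivative_position:
  assumes "i < 3" "t \<in> J"
  shows "vector_derivative (a i) (at t) = v i t"
  using vector_derivative_at[OF velocity[OF assms]] .

lemma has_acceleration:
  assumes "i < 3" "t \<in> J"
  shows "((\<lambda>s. vector_derivative (a i) (at s)) has_vector_derivative w i t) (at t)"
  using has_vector_derivative_transform_within_open[OF acceleration[OF assms] open_J assms(2)]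
    vector_derivative_position assms(1) by simp

lemma ang_mom_eq:
  assumes "t \<in> J"
  shows "ang_mom m a t = (\<Sum>i<3. m i * cross2 (a i t) (v i t))"
  unfolding ang_mom_def using vector_derivative_position assms by simp

text \<open>The common tool for differentiating conserved quantities: centre of mass, angular
  momentum, and the unit modulus of a rotation.\<close>

lemma has_derivative_zero_on:
  assumes "\<And>s. s \<in> J \<Longrightarrow> f s = c" "t \<in> J" "(f has_vector_derivative d) (at t)"
  shows "d = 0"
proof -
  have "(f has_vector_derivative 0) (at t)"
    using has_vector_derivative_transform_within_open[OF has_vector_derivative_const open_J assms(2)]
      assms(1) by metis
  then show ?thesis using assms(3) vector_derivative_unique_at by blast
qed

lemma centre_velocity:
  assumes t: "t \<in> J"
  shows "(\<Sum>i<3. complex_of_real (m i) * v i t) = 0"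
  using centre t
  by (rule has_derivative_zero_on)
    (auto intro!: derivative_eq_intros velocity t)

lemma centre_acceleration:
  assumes t: "t \<in> J"
  shows "(\<Sum>i<3. complex_of_real (m i) * w i t) = 0"
  using centre_velocity t
  by (rule has_derivative_zero_on)
    (auto intro!: derivative_eq_intros acceleration t)

lemma triangle: "t \<in> J \<Longrightarrow> centred_triangle m (\<lambda>i. a i t)"
  using masses centre by unfold_locales auto

lemma Imom_eq: "Imom m a i t = m i * inner (a i t) (a i t)"
  by (simp add: Imom_def power2_norm_eq_inner)

lemma has_real_derivative_Imom:
  assumes "i < 3" "t \<in> J"
  shows "(Imom m a i has_real_derivative 2 * m i * inner (a i t) (v i t)) (at t)"
  unfolding Imom_eq[abs_def] has_real_derivative_iff_has_vector_derivative
  by (auto intro!: derivative_eq_intros velocity assms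
        bounded_bilinear.has_vector_derivative[OF bounded_bilinear_inner]
      simp: inner_commute)

lemma deriv_Imom:
  assumes "i < 3" "t \<in> J"
  shows "deriv (Imom m a i) t = 2 * m i * inner (a i t) (v i t)"
  using DERIV_imp_deriv[OF has_real_derivative_Imom[OF assms]] .

lemma has_real_derivative_deriv_Imom:
  assumes "i < 3" "t \<in> J"
  shows "(deriv (Imom m a i) has_real_derivative
     2 * m i * (cmod (v i t))\<^sup>2 + 2 * inner (a i t) (complex_of_real (m i) * w i t)) (at t)"
proof -
  have "((\<lambda>t. 2 * m i * inner (a i t) (v i t)) has_real_derivative
     2 * m i * (cmod (v i t))\<^sup>2 + 2 * inner (a i t) (complex_of_real (m i) * w i t)) (at t)"
    unfolding has_real_derivative_iff_has_vector_derivative scaleR_conv_of_real[symmetric]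
    by (auto intro!: derivative_eq_intros velocity acceleration assms
        bounded_bilinear.has_vector_derivative[OF bounded_bilinear_inner]
      simp: power2_norm_eq_inner algebra_simps)
  then show ?thesis
    by (rule has_field_derivative_transform_within_open[OF _ open_J assms(2)])
      (simp add: deriv_Imom assms)
qed

lemma deriv_deriv_Imom:
  assumes "i < 3" "t \<in> J"
  shows "deriv (deriv (Imom m a i)) t =
    2 * m i * (cmod (v i t))\<^sup>2 + 2 * inner (a i t) (complex_of_real (m i) * w i t)"
  using DERIV_imp_deriv[OF has_real_derivative_deriv_Imom[OF assms]] .

text \<open>The second derivative of a moment contains the same term 2 m_i |v_i|^2 as the right
  side; once it cancels, only the radial component of the residual remains. As an equivalence it
  serves both directions of the correspondence.\<close>

lemma reduced_newton_at_Imom_iff: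
  assumes t: "t \<in> J" and nc: "signed_area (\<lambda>i. a i t) \<noteq> 0"
  shows "reduced_newton_at m (ang_mom m a t) (sgn (signed_area (\<lambda>i. a i t))) (Imom m a) t \<longleftrightarrow>
    (\<forall>i<3. inner (a i t) (complex_of_real (m i) * w i t - force m (\<lambda>i. a i t) i) = 0)"
proof -
  interpret centred_triangle m "\<lambda>i. a i t" by (rule triangle[OF t])
  have "reduced_newton m (ang_mom m a t) (sgn (signed_area (\<lambda>i. a i t)))
      (\<lambda>i. Imom m a i t) (\<lambda>i. deriv (Imom m a i) t) (\<lambda>i. deriv (deriv (Imom m a i)) t) \<longleftrightarrow>
    reduced_newton m (\<Sum>i<3. m i * cross2 (a i t) (v i t)) (sgn (signed_area (\<lambda>i. a i t)))
      (moments m (\<lambda>i. a i t)) (moment_rates m (\<lambda>i. a i t) (\<lambda>i. v i t))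
      (\<lambda>i. deriv (deriv (Imom m a i)) t)"
    unfolding ang_mom_eq[OF t] by (rule reduced_newton_cong) (simp_all add: Imom_def deriv_Imom t)
  also have "\<dots> \<longleftrightarrow> (\<forall>i<3. deriv (deriv (Imom m a i)) t =
      2 * m i * (cmod (v i t))\<^sup>2 + 2 * inner (a i t) (force m (\<lambda>i. a i t) i))"
    by (rule reduced_newton_iff[OF centre_velocity[OF t] nc])
  also have "\<dots> \<longleftrightarrow> (\<forall>i<3. inner (a i t) (complex_of_real (m i) * w i t - force m (\<lambda>i. a i t) i) = 0)"
    by (intro all_cong1 imp_cong refl) (simp add: deriv_deriv_Imom t inner_diff_right)
  finally have eq: "reduced_newton m (ang_mom m a t) (sgn (signed_area (\<lambda>i. a i t)))
      (\<lambda>i. Imom m a i t) (\<lambda>i. deriv (Imom m a i) t) (\<lambda>i. deriv (deriv (Imom m a i)) t) \<longleftrightarrow>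
      (\<forall>i<3. inner (a i t) (complex_of_real (m i) * w i t - force m (\<lambda>i. a i t) i) = 0)" .
  have "\<forall>i<3. (Imom m a i has_real_derivative deriv (Imom m a i) t) (at t) \<and>
            (deriv (Imom m a i) has_real_derivative deriv (deriv (Imom m a i)) t) (at t)"
    using has_real_derivative_Imom has_real_derivative_deriv_Imom t deriv_Imom deriv_deriv_Imom by simp
  then show ?thesis
    unfolding reduced_newton_at_def using eq by blast
qed

lemma three_body_motionI:
  assumes "\<And>i j t. i < 3 \<Longrightarrow> j < 3 \<Longrightarrow> i \<noteq> j \<Longrightarrow> t \<in> J \<Longrightarrow> a i t \<noteq> a j t"
    and "\<And>i t. i < 3 \<Longrightarrow> t \<in> J \<Longrightarrow> complex_of_real (m i) * w i t = force m (\<lambda>i. a i t) i"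
  shows "three_body_motion m a J"
  unfolding three_body_motion_def force_def[of m "\<lambda>i. a i _", symmetric]
  using assms centre velocity vector_derivative_position has_acceleration
     vector_derivative_at[OF has_acceleration] by simp

lemma torque_acceleration:
  assumes "\<And>s. s \<in> J \<Longrightarrow> ang_mom m a s = \<Omega>" and t: "t \<in> J"
  shows "(\<Sum>i<3. cross2 (a i t) (complex_of_real (m i) * w i t)) = 0"
proof -
  \<comment> \<open>As an inner product with a turned vector, the cross product falls under the
    product rule for bounded bilinear maps.\<close>
  have c: "cross2 x y = inner (\<i> * x) y" for x y by (simp add: cross2_simps inner_complex_def)
  have "(\<Sum>i<3. m i * cross2 (a i s) (v i s)) = \<Omega>" if "s \<in> J" for s
    using assms(1)[OF that] ang_mom_eq[OF that] by simp
  moreover have "((\<lambda>s. \<Sum>i<3. m i * cross2 (a i s) (v i s)) has_vector_derivative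
      (\<Sum>i<3. cross2 (a i t) (complex_of_real (m i) * w i t))) (at t)"
  proof (rule has_vector_derivative_sum)
    fix i :: nat assume "i \<in> {..<3}"
    then have i: "i < 3" by simp
    have "((\<lambda>s. inner (\<i> * a i s) (v i s)) has_vector_derivative
        inner (\<i> * a i t) (w i t) + inner (\<i> * v i t) (v i t)) (at t)"
      by (intro bounded_bilinear.has_vector_derivative[OF bounded_bilinear_inner]
          has_vector_derivative_mult_right velocity acceleration i t)
    moreover have "inner (\<i> * v i t) (v i t) = 0" by (simp add: inner_complex_def)
    ultimately have "((\<lambda>s. m i * inner (\<i> * a i s) (v i s)) has_vector_derivative
        m i * inner (\<i> * a i t) (w i t)) (at t)"
      by (intro has_vector_derivative_mult_right) simp
    moreover have "m i * inner (\<i> * a i t) (w i t) = inner (\<i> * a i t) (complex_of_real (m i) * w i t)"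
      by (simp add: inner_complex_def algebra_simps)
    ultimately show "((\<lambda>s. m i * cross2 (a i s) (v i s)) has_vector_derivative
      cross2 (a i t) (complex_of_real (m i) * w i t)) (at t)" unfolding c by simp
  qed
  ultimately show ?thesis by (intro has_derivative_zero_on[OF _ t])
qed

end

section \<open>Newtonian motions: the reduced equation and uniqueness\<close>

lemma three_body_motion_kinematics:
  assumes "masses_ok m" "open J" "three_body_motion m a J"
  shows "kinematics m a (\<lambda>i t. vector_derivative (a i) (at t))
     (\<lambda>i t. vector_derivative (\<lambda>s. vector_derivative (a i) (at s)) (at t)) J"
  using assms by unfold_locales (auto simp: three_body_motion_def)

lemma three_body_motion_reduced_newton:
  assumes "masses_ok m" "open J" "three_body_motion m a J" "t \<in> J" "\<not> collinear3 (\<lambda>i. a i t)"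
  shows "reduced_newton_at m (ang_mom m a t) (sgn (signed_area (\<lambda>i. a i t))) (Imom m a) t"
proof -
  interpret kinematics m a "\<lambda>i t. vector_derivative (a i) (at t)"
     "\<lambda>i t. vector_derivative (\<lambda>s. vector_derivative (a i) (at s)) (at t)" J
    by (rule three_body_motion_kinematics) fact+
  show ?thesis
    using assms by (subst reduced_newton_at_Imom_iff) (auto simp: collinear3_def three_body_motion_def force_def)
qed

text \<open>The rotation carrying one motion to the other is the quotient of a Hermitian product by the
  total moment of inertia, hence differentiable; the difference of the angular momenta is the total
  moment times its angular velocity.\<close>

lemma three_body_motion_unique:
  assumes "masses_ok m" "open J" "is_interval J" "t0 \<in> J"
    and a: "three_body_motion m a J" and b: "three_body_motion m b J"
    and ang: "\<And>t. t \<in> J \<Longrightarrow> ang_mom m a t = ang_mom m b t"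
    and init: "\<And>i. i < 3 \<Longrightarrow> b i t0 = a i t0"
    and same: "same_moduli_curve a b J" and "t \<in> J" "i < 3"
  shows "b i t = a i t"
proof -
  define v where "v = (\<lambda>i t. vector_derivative (a i) (at t))"
  define v' where "v' = (\<lambda>i t. vector_derivative (b i) (at t))"
  interpret a: kinematics m a v "\<lambda>i t. vector_derivative (\<lambda>s. vector_derivative (a i) (at s)) (at t)" J
    unfolding v_def by (rule three_body_motion_kinematics) fact+
  interpret b: kinematics m b v' "\<lambda>i t. vector_derivative (\<lambda>s. vector_derivative (b i) (at s)) (at t)" J
    unfolding v'_def by (rule three_body_motion_kinematics) fact+
  define N where "N = (\<lambda>t. \<Sum>i<3. complex_of_real (m i) * (cnj (a i t) * a i t))"
  define u where "u = (\<lambda>t. (\<Sum>i<3. complex_of_real (m i) * (cnj (a i t) * b i t)) / N t)"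
  have N: "N t = of_real (Itot (moments m (\<lambda>i. a i t)))" for t
    by (simp add: N_def Itot_def sum_less_3 complex_norm_square algebra_simps del: of_real_power)
  have Npos: "Itot (moments m (\<lambda>i. a i t)) > 0" if "t \<in> J" for t
    by (rule centred_triangle.Itot_pos[OF a.triangle[OF that]])
      (use that a in \<open>simp add: three_body_motion_def\<close>)
  have u: "cmod (u s) = 1 \<and> (\<forall>i<3. b i s = u s * a i s)" if s: "s \<in> J" for s
  proof -
    obtain z where z: "cmod z = 1" "\<forall>i<3. b i s = z * a i s"
      using same s unfolding same_moduli_curve_def by blast
    have "(\<Sum>i<3. complex_of_real (m i) * (cnj (a i s) * b i s)) = z * N s"
      using z(2) by (simp add: N_def sum_less_3 algebra_simps)
    then have "u s = z" using Npos[OF s] N[of s] by (simp add: u_def)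
    then show ?thesis using z by simp
  qed
  have "\<exists>d. (u has_vector_derivative d) (at s)" if s: "s \<in> J" for s
  proof -
    have Ns: "N s \<noteq> 0" using Npos[OF s] unfolding N by simp
    have "a i differentiable (at s)" "b i differentiable (at s)" if "i < 3" for i
      using a.velocity[OF that s] b.velocity[OF that s] differentiableI_vector by blast+
    moreover have "(\<lambda>s. cnj (a i s)) differentiable (at s)" if "i < 3" for i
      using bounded_linear.has_vector_derivative[OF bounded_linear_cnj a.velocity[OF that s]]
        differentiableI_vector by blast
    ultimately have "u differentiable (at s)"
      using Ns unfolding u_def N_def
      by (intro differentiable_divide differentiable_sum differentiable_mult differentiable_const ballI) simp_all
    then show ?thesis using vector_derivative_works by blast
  qed
  then obtain u' where u': "(u has_vector_derivative u' s) (at s)" if "s \<in> J" for s by metis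
  have "u' s = 0" if s: "s \<in> J" for s
  proof -
    have us: "u s * cnj (u s) = 1" using u[OF s] by (simp add: complex_norm_square[symmetric])
    have "u r * cnj (u r) = 1" if "r \<in> J" for r
      using u[OF that] by (simp add: complex_norm_square[symmetric])
    then have "u s * cnj (u' s) + u' s * cnj (u s) = 0"
      using s by (rule a.has_derivative_zero_on)
        (auto intro!: derivative_eq_intros u'[OF s]
          bounded_linear.has_vector_derivative[OF bounded_linear_cnj])
    \<comment> \<open>Unit modulus makes this product purely imaginary; its imaginary part, named
      \<open>q\<close> below, is the angular velocity of the rotation.\<close>
    then have re: "Re (cnj (u s) * u' s) = 0"
      by (simp add: complex_eq_iff algebra_simps)
    have v's: "v' i s = u s * v i s + u' s * a i s" if i: "i < 3" for i
    proof -
      have "((\<lambda>s. u s * a i s) has_vector_derivative u s * v i s + u' s * a i s) (at s)"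
        by (auto intro!: derivative_eq_intros u'[OF s] a.velocity i s)
      then have "(b i has_vector_derivative u s * v i s + u' s * a i s) (at s)"
        by (rule has_vector_derivative_transform_within_open[OF _ \<open>open J\<close> s]) (use u i in auto)
      then show ?thesis using b.velocity[OF i s] vector_derivative_unique_at by blast
    qed
    have bv: "cross2 (b i s) (v' i s) = cross2 (a i s) (v i s) + Im (cnj (u s) * u' s) * (cmod (a i s))\<^sup>2"
      if i: "i < 3" for i
    proof -
      have "cnj (b i s) * v' i s = (u s * cnj (u s)) * (cnj (a i s) * v i s)
          + (cnj (u s) * u' s) * (a i s * cnj (a i s))"
        using u[OF s] i by (simp add: v's algebra_simps)
      also have "\<dots> = cnj (a i s) * v i s + (cnj (u s) * u' s) * of_real ((cmod (a i s))\<^sup>2)"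
        unfolding us by (simp add: complex_norm_square del: of_real_power)
      finally show ?thesis unfolding cross2_def by simp
    qed
    define q where "q = Im (cnj (u s) * u' s)"
    have "ang_mom m b s = ang_mom m a s + q * Itot (moments m (\<lambda>i. a i s))"
      unfolding a.ang_mom_eq[OF s] b.ang_mom_eq[OF s] sum_less_3 Itot_def
      by (simp add: bv[folded q_def] algebra_simps)
    then have "Im (cnj (u s) * u' s) = 0" using ang[OF s] Npos[OF s] by (simp add: q_def)
    then have "cnj (u s) * u' s = 0" using re by (simp add: complex_eq_iff)
    then show ?thesis using us by auto
  qed
  then have "\<exists>c. \<forall>s\<in>J. u s = c"
    using has_vector_derivative_zero_constant[of J u] u' assms(3)
    by (metis has_vector_derivative_at_within is_interval_convex)
  then have "u t = u t0" using \<open>t \<in> J\<close> \<open>t0 \<in> J\<close> by metis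
  moreover have "u t0 = 1"
    using Npos[OF \<open>t0 \<in> J\<close>] N[of t0] init by (simp add: u_def N_def)
  ultimately show ?thesis using u[OF \<open>t \<in> J\<close>] \<open>i < 3\<close> by simp
qed

subsection \<open>Triangles with prescribed moments\<close>

text \<open>In a centred triangle the vectors m_i a_i add up to zero, so they bound a triangle with
  squared sides m_i I_i and area m0 m1 m2 times the original area. The right side is Heron's formula
  for it. Here the identity is proved algebraically, with no configuration at hand.\<close>

lemma heron16_moment_form:
  assumes "masses_ok m"
  shows "(m 0 * m 1 * m 2)\<^sup>2 * heron16 m I =
    4 * (m 0 * I 0) * (m 1 * I 1) - (m 0 * I 0 + m 1 * I 1 - m 2 * I 2)\<^sup>2"
proof -
  have pos: "m 0 > 0" "m 1 > 0" "m 2 > 0" and m2: "m 2 = 1 - m 0 - m 1"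
    using assms by (auto simp: masses_ok_def all_less_3)
  define x y z where "x = rsq m I 0 1" and "y = rsq m I 1 2" and "z = rsq m I 0 2"
  define M where "M = m 0 * m 1 * m 2"
  have X: "M * x = m 2 * ((1 - m 2) * Itot I - I 2)"
    and Y: "M * y = m 0 * ((1 - m 0) * Itot I - I 0)"
    and Z: "M * z = m 1 * ((1 - m 1) * Itot I - I 1)"
    using pos by (simp_all add: x_def y_def z_def rsq_def M_def field_simps)
  have "M\<^sup>2 * heron16 m I = 2 * ((M * x) * (M * y) + (M * y) * (M * z) + (M * z) * (M * x))
      - ((M * x)\<^sup>2 + (M * y)\<^sup>2 + (M * z)\<^sup>2)"
    unfolding heron16_def Let_def x_def[symmetric] y_def[symmetric] z_def[symmetric] by algebra
  also have "\<dots> = 4 * (m 0 * I 0) * (m 1 * I 1) - (m 0 * I 0 + m 1 * I 1 - m 2 * I 2)\<^sup>2"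
    unfolding X Y Z Itot_def using m2 by algebra
  finally show ?thesis by (simp add: M_def)
qed

text \<open>Heron's form makes the moments share one sign, and positivity of the squared distances
  makes their sum positive.\<close>

lemma noncollinear_mod_pos:
  assumes "masses_ok m" "noncollinear_mod m I"
  shows "I 0 > 0" "I 1 > 0" "I 2 > 0"
proof -
  have pos: "m 0 > 0" "m 1 > 0" "m 2 > 0" and sum: "m 0 + m 1 + m 2 = 1"
    using assms by (auto simp: masses_ok_def all_less_3)
  have nc: "rsq m I 0 1 > 0" "rsq m I 1 2 > 0" "rsq m I 0 2 > 0" "heron16 m I > 0"
    using assms(2) by (auto simp: noncollinear_mod_def)
  have h: "(m 0 * m 1 * m 2)\<^sup>2 * heron16 m I > 0" using pos nc by simp
  note hm = heron16_moment_form[OF assms(1), of I]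
  have "4 * (m 0 * I 0) * (m 1 * I 1) > 0"
    using h hm zero_le_power2[of "m 0 * I 0 + m 1 * I 1 - m 2 * I 2"] by linarith
  then have a: "I 0 * I 1 > 0" using pos by (auto simp: zero_less_mult_iff mult_less_0_iff)
  \<comment> \<open>The form is symmetric in the three products m_i I_i, so the indices may be
    rotated.\<close>
  have "4 * (m 1 * I 1) * (m 2 * I 2) - (m 1 * I 1 + m 2 * I 2 - m 0 * I 0)\<^sup>2 > 0"
    using h unfolding hm by (simp add: algebra_simps power2_eq_square)
  then have "4 * (m 1 * I 1) * (m 2 * I 2) > 0"
    using zero_le_power2[of "m 1 * I 1 + m 2 * I 2 - m 0 * I 0"] by linarith
  then have b: "I 1 * I 2 > 0" using pos by (auto simp: zero_less_mult_iff mult_less_0_iff)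
  have "(1 - m 2) * Itot I - I 2 > 0" "(1 - m 0) * Itot I - I 0 > 0" "(1 - m 1) * Itot I - I 1 > 0"
    using nc pos by (simp_all add: rsq_def zero_less_divide_iff mult_less_0_iff)
  \<comment> \<open>The sum of the three numerators; since the masses add up to 1, it equals the
    total moment.\<close>
  then have "(3 - (m 0 + m 1 + m 2)) * Itot I - Itot I > 0"
    by (simp add: Itot_def algebra_simps)
  then have "Itot I > 0" unfolding sum by simp
  then show "I 0 > 0" "I 1 > 0" "I 2 > 0"
    using a b unfolding Itot_def by (auto simp: zero_less_mult_iff)
qed

text \<open>By the law of cosines and Heron's formula, multiplication by this number carries body 0
  to body 1.\<close>

definition vertex_ratio :: "(nat \<Rightarrow> real) \<Rightarrow> real \<Rightarrow> (nat \<Rightarrow> real) \<Rightarrow> complex" where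
  "vertex_ratio m eps I =
    Complex ((m 2 * I 2 - m 0 * I 0 - m 1 * I 1) / 2) (2 * (m 0 * m 1 * m 2) * Delta_mod m eps I)
      / complex_of_real (m 1 * I 0)"

text \<open>The numbers \<open>c\<close> and \<open>D\<close> are the intended values of m0 m1 times
  the inner and the cross product of q0 and q1. Heron's form gives c^2 + D^2 = (m0 I0)(m1 I1), so q1
  has the right length. The area follows from \<open>D\<close>, and the third moment from
  \<open>c\<close> by the law of cosines.\<close>

lemma vertex_ratio_triangle:
  assumes "masses_ok m" "noncollinear_mod m I" "eps = 1 \<or> eps = -1"
    and q0: "m 0 * (cmod (q 0))\<^sup>2 = I 0" and q1: "q 1 = q 0 * vertex_ratio m eps I"
    and q2: "q 2 = - (complex_of_real (m 0) * q 0 + complex_of_real (m 1) * q 1) / complex_of_real (m 2)"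
  shows "centred_triangle m q" "\<And>i. i < 3 \<Longrightarrow> moments m q i = I i" "signed_area q = Delta_mod m eps I"
proof -
  have pos: "m 0 > 0" "m 1 > 0" "m 2 > 0" using assms by (auto simp: masses_ok_def all_less_3)
  have "(\<Sum>i<3. complex_of_real (m i) * q i) = 0"
    using pos by (simp add: sum_less_3 q2 del: One_nat_def)
  then show ct: "centred_triangle m q" using assms(1) by unfold_locales
  interpret centred_triangle m q by fact
  define c D where "c = (m 2 * I 2 - m 0 * I 0 - m 1 * I 1) / 2" and "D = 2 * (m 0 * m 1 * m 2) * Delta_mod m eps I"
  have I0: "I 0 > 0" and h: "heron16 m I > 0"
    using noncollinear_mod_pos[OF assms(1,2)] assms(2) by (auto simp: noncollinear_mod_def)
  have "eps\<^sup>2 = 1" using assms(3) by auto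
  then have "4 * D\<^sup>2 = (m 0 * m 1 * m 2)\<^sup>2 * heron16 m I"
    using h by (simp add: D_def Delta_mod_def power_mult_distrib power_divide)
  then have cD: "c\<^sup>2 + D\<^sup>2 = (m 0 * I 0) * (m 1 * I 1)"
    unfolding heron16_moment_form[OF assms(1)] by (simp add: c_def power_divide) algebra
  have r: "vertex_ratio m eps I = Complex c D / complex_of_real (m 1 * I 0)"
    by (simp add: vertex_ratio_def c_def D_def)
  have "(cmod (q 1))\<^sup>2 = (cmod (q 0))\<^sup>2 * (c\<^sup>2 + D\<^sup>2) / (m 1 * I 0)\<^sup>2"
    by (simp add: q1 r norm_mult norm_divide power_mult_distrib power_divide complex_norm del: One_nat_def)
  also have "(cmod (q 0))\<^sup>2 = I 0 / m 0" using q0 pos by (simp add: field_simps)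
  finally have M1: "m 1 * (cmod (q 1))\<^sup>2 = I 1"
    unfolding cD using pos I0 by (simp add: field_simps power2_eq_square)
  have prod: "cnj (q 0) * q 1 = Complex c D / complex_of_real (m 0 * m 1)"
  proof -
    have "cnj (q 0) * q 1 = (q 0 * cnj (q 0)) * vertex_ratio m eps I" by (simp add: q1 del: One_nat_def)
    also have "q 0 * cnj (q 0) = complex_of_real (I 0 / m 0)"
      using q0 pos by (simp add: complex_norm_square[symmetric] field_simps del: of_real_power)
        (metis of_real_mult)
    finally show ?thesis unfolding r using pos I0 by (simp add: field_simps)
  qed
  have "inner (q 0) (q 1) = Re (cnj (q 0) * q 1)" by (simp add: inner_complex_def)
  then have inn: "m 0 * m 1 * inner (q 0) (q 1) = c"
    unfolding prod using pos by (simp add: Re_divide_of_real del: of_real_mult)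
  have "cross2 (q 0) (q 1) = D / (m 0 * m 1)"
    unfolding cross2_def prod by (simp add: Im_divide_of_real del: of_real_mult)
  then have "m 0 * m 1 * cross2 (q 0) (q 1) = D" using pos by simp
  then show "signed_area q = Delta_mod m eps I"
    using cross2_signed_area(1) pos by (simp add: D_def)
  have "2 * c = m 2 * (m 2 * (cmod (q 2))\<^sup>2) - m 0 * I 0 - m 1 * I 1"
    using inner_barycentric[OF centre_cyclic(1)] inn q0 M1 by (simp add: power2_eq_square algebra_simps)
  then have M2: "m 2 * (cmod (q 2))\<^sup>2 = I 2" using pos by (simp add: c_def)
  show "moments m q i = I i" if "i < 3" for i
    using less_3_cases[OF that] q0 M1 M2 by auto
qed

text \<open>The converse of the construction: the real and imaginary parts of cnj p0 times p1 are
  the inner and the cross product, both fixed by moments and orientation. It identifies the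
  constructed initial triangle with a prescribed one.\<close>

lemma (in centred_triangle) vertex_ratio:
  assumes nc: "signed_area p \<noteq> 0" and I: "\<And>i. i < 3 \<Longrightarrow> moments m p i = I i"
  shows "p 1 = p 0 * vertex_ratio m (sgn (signed_area p)) I"
    "p 2 = - (complex_of_real (m 0) * p 0 + complex_of_real (m 1) * p 1) / complex_of_real (m 2)"
proof -
  have I3: "m 0 * (cmod (p 0))\<^sup>2 = I 0" "m 1 * (cmod (p 1))\<^sup>2 = I 1" "m 2 * (cmod (p 2))\<^sup>2 = I 2"
    using I by auto
  have p0: "p 0 \<noteq> 0" using noncollinear_nonzero[OF nc] by simp
  have pos: "m 0 > 0" "m 1 > 0" "m 2 > 0" using mass_pos by auto
  have "heron16 m (moments m p) = heron16 m I"
    unfolding heron16_def rsq_def Itot_def using I3 by simp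
  then have "Delta_mod m (sgn (signed_area p)) I = signed_area p"
    using Delta_mod_moments by (simp add: Delta_mod_def)
  then have im: "2 * (m 0 * m 1 * m 2) * Delta_mod m (sgn (signed_area p)) I = m 0 * m 1 * cross2 (p 0) (p 1)"
    unfolding cross2_signed_area(1) by simp
  have re: "(m 2 * I 2 - m 0 * I 0 - m 1 * I 1) / 2 = m 0 * m 1 * inner (p 0) (p 1)"
    using inner_barycentric[OF centre_cyclic(1)] unfolding I3[symmetric] by (simp add: power2_eq_square algebra_simps)
  have "Complex (m 0 * m 1 * inner (p 0) (p 1)) (m 0 * m 1 * cross2 (p 0) (p 1))
      = complex_of_real (m 0 * m 1) * (cnj (p 0) * p 1)"
    by (simp add: complex_eq_iff inner_complex_def cross2_simps)
  moreover have "complex_of_real (m 1 * I 0) = complex_of_real (m 0 * m 1) * (p 0 * cnj (p 0))"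
    unfolding complex_norm_square[symmetric] I3[symmetric] by simp
  ultimately have "vertex_ratio m (sgn (signed_area p)) I =
      complex_of_real (m 0 * m 1) * (cnj (p 0) * p 1) / (complex_of_real (m 0 * m 1) * (p 0 * cnj (p 0)))"
    unfolding vertex_ratio_def im re by (simp only:)
  also have "\<dots> = p 1 / p 0"
    using p0 pos by simp
  finally show "p 1 = p 0 * vertex_ratio m (sgn (signed_area p)) I" using p0 by simp
  show "p 2 = - (complex_of_real (m 0) * p 0 + complex_of_real (m 1) * p 1) / complex_of_real (m 2)"
    using centre pos by (simp add: sum_less_3 field_simps eq_neg_iff_add_eq_0)
qed

subsection \<open>Twice differentiable curves\<close>

text \<open>Second derivatives exist pointwise and need not be continuous, which is the regularity
  that a reduced solution provides and that \<open>kinematics\<close> asks for.\<close>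

definition twice_differentiable_on :: "(real \<Rightarrow> 'a::real_normed_vector) \<Rightarrow> real set \<Rightarrow> bool" where
  "twice_differentiable_on f J \<longleftrightarrow> (\<exists>f' f''. \<forall>t\<in>J.
    (f has_vector_derivative f' t) (at t) \<and> (f' has_vector_derivative f'' t) (at t))"

lemma twice_differentiable_onI:
  assumes "\<And>t. t \<in> J \<Longrightarrow> (f has_vector_derivative f' t) (at t)"
    and "\<And>t. t \<in> J \<Longrightarrow> (f' has_vector_derivative f'' t) (at t)"
  shows "twice_differentiable_on f J"
  using assms unfolding twice_differentiable_on_def by blast

lemma twice_differentiable_onI':
  assumes "\<And>t. t \<in> J \<Longrightarrow> (f has_vector_derivative f' t) (at t)"
    and "\<And>t. t \<in> J \<Longrightarrow> f' differentiable (at t)"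
  shows "twice_differentiable_on f J"
  using assms(1) assms(2)[unfolded vector_derivative_works] by (rule twice_differentiable_onI)

lemma twice_differentiable_on_imp_differentiable:
  "twice_differentiable_on f J \<Longrightarrow> t \<in> J \<Longrightarrow> f differentiable (at t)"
  unfolding twice_differentiable_on_def using differentiableI_vector by blast

named_theorems td_intros

lemma twice_differentiable_on_const [td_intros]: "twice_differentiable_on (\<lambda>t. c) J"
  by (rule twice_differentiable_onI) (rule has_vector_derivative_const)+

lemma twice_differentiable_on_add [td_intros]:
  assumes "twice_differentiable_on f J" "twice_differentiable_on g J"
  shows "twice_differentiable_on (\<lambda>t. f t + g t) J"
proof -
  obtain f' f'' g' g'' where d:
    "\<And>t. t \<in> J \<Longrightarrow> (f has_vector_derivative f' t) (at t)" "\<And>t. t \<in> J \<Longrightarrow> (f' has_vector_derivative f'' t) (at t)"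
    "\<And>t. t \<in> J \<Longrightarrow> (g has_vector_derivative g' t) (at t)" "\<And>t. t \<in> J \<Longrightarrow> (g' has_vector_derivative g'' t) (at t)"
    using assms unfolding twice_differentiable_on_def by blast
  show ?thesis
    by (rule twice_differentiable_onI[OF has_vector_derivative_add[OF d(1,3)] has_vector_derivative_add[OF d(2,4)]])
qed

lemma twice_differentiable_on_mult [td_intros]:
  fixes f g :: "real \<Rightarrow> 'a::real_normed_algebra"
  assumes "twice_differentiable_on f J" "twice_differentiable_on g J"
  shows "twice_differentiable_on (\<lambda>t. f t * g t) J"
proof -
  obtain f' f'' g' g'' where d:
    "\<And>t. t \<in> J \<Longrightarrow> (f has_vector_derivative f' t) (at t)" "\<And>t. t \<in> J \<Longrightarrow> (f' has_vector_derivative f'' t) (at t)"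
    "\<And>t. t \<in> J \<Longrightarrow> (g has_vector_derivative g' t) (at t)" "\<And>t. t \<in> J \<Longrightarrow> (g' has_vector_derivative g'' t) (at t)"
    using assms unfolding twice_differentiable_on_def by blast
  show ?thesis
    by (rule twice_differentiable_onI[OF has_vector_derivative_mult[OF d(1,3)]
          has_vector_derivative_add[OF has_vector_derivative_mult[OF d(1,4)] has_vector_derivative_mult[OF d(2,3)]]])
qed

lemma twice_differentiable_on_uminus [td_intros]:
  fixes f :: "real \<Rightarrow> 'a::real_normed_algebra_1"
  assumes "twice_differentiable_on f J"
  shows "twice_differentiable_on (\<lambda>t. - f t) J"
  using twice_differentiable_on_mult[OF twice_differentiable_on_const[of "-1"] assms] by simp

lemma twice_differentiable_on_diff [td_intros]:
  fixes f g :: "real \<Rightarrow> 'a::real_normed_algebra_1"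
  assumes "twice_differentiable_on f J" "twice_differentiable_on g J"
  shows "twice_differentiable_on (\<lambda>t. f t - g t) J"
  using twice_differentiable_on_add[OF assms(1) twice_differentiable_on_uminus[OF assms(2)]] by simp

lemma twice_differentiable_on_power2 [td_intros]:
  fixes f :: "real \<Rightarrow> 'a::real_normed_algebra_1"
  assumes "twice_differentiable_on f J"
  shows "twice_differentiable_on (\<lambda>t. (f t)\<^sup>2) J"
  unfolding power2_eq_square by (intro td_intros assms)

lemma twice_differentiable_on_divide_const [td_intros]:
  fixes f :: "real \<Rightarrow> 'a::real_normed_field"
  assumes "twice_differentiable_on f J"
  shows "twice_differentiable_on (\<lambda>t. f t / c) J"
  unfolding divide_inverse by (intro td_intros assms)

lemma twice_differentiable_on_compose:
  fixes f :: "real \<Rightarrow> real"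
  assumes "twice_differentiable_on f J" "twice_differentiable_on g S" "f ` J \<subseteq> S"
  shows "twice_differentiable_on (\<lambda>t. g (f t)) J"
proof -
  obtain f' f'' g' g'' where d:
    "\<And>t. t \<in> J \<Longrightarrow> (f has_vector_derivative f' t) (at t)" "\<And>t. t \<in> J \<Longrightarrow> (f' has_vector_derivative f'' t) (at t)"
    "\<And>t. t \<in> S \<Longrightarrow> (g has_vector_derivative g' t) (at t)" "\<And>t. t \<in> S \<Longrightarrow> (g' has_vector_derivative g'' t) (at t)"
    using assms(1,2) unfolding twice_differentiable_on_def by blast
  have S: "f t \<in> S" if "t \<in> J" for t using assms(3) that by auto
  have "((\<lambda>t. g (f t)) has_vector_derivative f' t *\<^sub>R g' (f t)) (at t)" if "t \<in> J" for t
    using vector_diff_chain_at[OF d(1)[OF that] d(3)[OF S[OF that]]] by (simp add: o_def)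
  moreover have "((\<lambda>t. f' t *\<^sub>R g' (f t)) has_vector_derivative
      f' t *\<^sub>R (f' t *\<^sub>R g'' (f t)) + f'' t *\<^sub>R g' (f t)) (at t)" if "t \<in> J" for t
    using vector_diff_chain_at[OF d(1)[OF that] d(4)[OF S[OF that]]] d(2)[OF that]
    by (intro has_vector_derivative_scaleR)
       (auto simp: o_def has_real_derivative_iff_has_vector_derivative)
  ultimately show ?thesis by (rule twice_differentiable_onI)
qed

lemma twice_differentiable_on_of_real [td_intros]:
  assumes "twice_differentiable_on f J"
  shows "twice_differentiable_on (\<lambda>t. of_real (f t) :: complex) J"
  using assms
proof (rule twice_differentiable_on_compose)
  show "twice_differentiable_on (of_real :: real \<Rightarrow> complex) UNIV"
    by (rule twice_differentiable_onI[OF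
          bounded_linear.has_vector_derivative[OF bounded_linear_of_real has_vector_derivative_id]
          has_vector_derivative_const])
qed simp

lemma twice_differentiable_on_cis [td_intros]:
  assumes "twice_differentiable_on f J"
  shows "twice_differentiable_on (\<lambda>t. cis (f t)) J"
  using assms
proof (rule twice_differentiable_on_compose)
  have cis: "(cis has_vector_derivative \<i> * cis x) (at x)" for x
    using has_derivative_cis[of "\<lambda>x. x" "\<lambda>x. x" x UNIV]
    by (simp add: has_vector_derivative_def scaleR_conv_of_real algebra_simps)
  show "twice_differentiable_on cis UNIV"
    by (rule twice_differentiable_onI[OF cis has_vector_derivative_mult_right[OF cis]])
qed simp

lemma twice_differentiable_on_inverse [td_intros]:
  fixes f :: "real \<Rightarrow> real"
  assumes "twice_differentiable_on f J" "\<And>t. t \<in> J \<Longrightarrow> f t > 0"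
  shows "twice_differentiable_on (\<lambda>t. inverse (f t)) J"
  using assms(1)
proof (rule twice_differentiable_on_compose)
  show "twice_differentiable_on (inverse :: real \<Rightarrow> real) {0<..}"
  proof (rule twice_differentiable_onI'[of _ _ "\<lambda>x. - (inverse x * inverse x)"])
    fix x :: real assume "x \<in> {0<..}"
    then show d: "(inverse has_vector_derivative - (inverse x * inverse x)) (at x)"
      using DERIV_inverse[of x] by (simp add: has_real_derivative_iff_has_vector_derivative power2_eq_square)
    show "(\<lambda>x::real. - (inverse x * inverse x)) differentiable (at x)"
      using differentiableI_vector[OF d] by (intro differentiable_minus differentiable_mult)
  qed
qed (use assms in auto)

lemma twice_differentiable_on_sqrt [td_intros]:
  assumes "twice_differentiable_on f J" "\<And>t. t \<in> J \<Longrightarrow> f t > 0"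
  shows "twice_differentiable_on (\<lambda>t. sqrt (f t)) J"
  using assms(1)
proof (rule twice_differentiable_on_compose)
  show "twice_differentiable_on sqrt {0<..}"
  proof (rule twice_differentiable_onI'[of _ _ "\<lambda>x. inverse (sqrt x) / 2"])
    fix x :: real assume x: "x \<in> {0<..}"
    then show d: "(sqrt has_vector_derivative inverse (sqrt x) / 2) (at x)"
      using DERIV_real_sqrt[of x] by (simp add: has_real_derivative_iff_has_vector_derivative)
    show "(\<lambda>x. inverse (sqrt x) / 2) differentiable (at x)"
      using x differentiableI_vector[OF d] by (intro differentiable_divide differentiable_inverse differentiable_const) auto
  qed
qed (use assms in auto)

text \<open>The interval may be unbounded and t may lie on either side of t0, so the fundamental
  theorem is applied on a compact piece chosen for each t.\<close>

lemma antiderivative_open_interval: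
  fixes f :: "real \<Rightarrow> real"
  assumes "open J" "is_interval J" "t0 \<in> J" "continuous_on J f"
  obtains F where "F t0 = c" "\<And>t. t \<in> J \<Longrightarrow> (F has_vector_derivative f t) (at t)"
proof (rule that[of "\<lambda>t. c + (LBINT y=t0..t. f y)"])
  show "c + (LBINT y=t0..t0. f y) = c" by simp
  fix t assume t: "t \<in> J"
  obtain e where e: "e > 0" "cball t e \<subseteq> J" using assms(1) t unfolding open_contains_cball by blast
  \<comment> \<open>The piece contains t0 and has t in its interior, so the derivative within it is
    a two-sided one.\<close>
  define a b where "a = min t0 (t - e)" and "b = max t0 (t + e)"
  have "t - e \<in> cball t e" "t + e \<in> cball t e" using e(1) by (simp_all add: dist_real_def)
  then have "t - e \<in> J" "t + e \<in> J" using e(2) by blast+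
  then have ab: "a \<in> J" "b \<in> J" using assms(3) by (simp_all add: a_def b_def min_def max_def)
  have "{a..b} \<subseteq> J"
    using mem_is_interval_1_I[OF assms(2) ab] by (meson atLeastAtMost_iff subsetI)
  then have "continuous_on {a..b} f" using assms(4) continuous_on_subset by blast
  moreover have "a \<le> t0" "t0 \<le> b" "a < t" "t < b" using e(1) by (simp_all add: a_def b_def)
  ultimately have "((\<lambda>u. LBINT y=t0..u. f y) has_vector_derivative f t) (at t within {a..b})"
    using interval_integral_FTC2[of a t0 b f t] by simp
  then have "((\<lambda>u. LBINT y=t0..u. f y) has_vector_derivative f t) (at t)"
    using at_within_Icc_at[OF \<open>a < t\<close> \<open>t < b\<close>] by simp
  from has_vector_derivative_add[OF has_vector_derivative_const this]
  show "((\<lambda>t. c + (LBINT y=t0..t. f y)) has_vector_derivative f t) (at t)" by simp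
qed

subsection \<open>Realization of reduced solutions\<close>

lemma deriv_cong_on_open:
  fixes f g :: "real \<Rightarrow> real"
  assumes "open J" "t \<in> J" "\<And>s. s \<in> J \<Longrightarrow> f s = g s"
  shows "deriv f t = deriv g t"
  using eventually_nhds_in_open[OF assms(1,2)]
  by (intro deriv_cong_ev refl) (auto elim: eventually_mono simp: assms(3))

text \<open>The radial velocity r' and the transverse velocity r \<omega>, read in the frame turned
  by \<phi>.\<close>

lemma has_vector_derivative_polar:
  assumes "(r has_real_derivative r') (at t)" "(\<phi> has_real_derivative \<omega>) (at t)"
  shows "((\<lambda>t. complex_of_real (r t) * cis (\<phi> t)) has_vector_derivative
    Complex r' (r t * \<omega>) * cis (\<phi> t)) (at t)"
proof -
  have "((\<lambda>t. cis (\<phi> t)) has_vector_derivative \<omega> *\<^sub>R (\<i> * cis (\<phi> t))) (at t)"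
    using has_derivative_cis[OF assms(2)[unfolded has_field_derivative_def]]
    by (simp add: has_vector_derivative_def scaleR_conv_of_real algebra_simps)
  moreover have "((\<lambda>t. complex_of_real (r t)) has_vector_derivative of_real r') (at t)"
    using assms(1) by (intro bounded_linear.has_vector_derivative[OF bounded_linear_of_real])
      (simp add: has_real_derivative_iff_has_vector_derivative)
  ultimately show ?thesis
    by (rule has_vector_derivative_eq_rhs[OF has_vector_derivative_mult[rotated]])
      (simp add: complex_eq_iff algebra_simps)
qed

locale reduced_curve =
  fixes m :: "nat \<Rightarrow> real" and \<Omega> eps :: real and Ib :: "nat \<Rightarrow> real \<Rightarrow> real" and J :: "real set"
  assumes masses: "masses_ok m" and open_J: "open J"
    and sol: "reduced_solution m \<Omega> eps Ib J" and eps: "eps = 1 \<or> eps = -1"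
begin

lemma mass_pos: "m 0 > 0" "m 1 > 0" "m 2 > 0"
  using masses by (auto simp: masses_ok_def all_less_3)

lemma noncollinear: "t \<in> J \<Longrightarrow> noncollinear_mod m (\<lambda>i. Ib i t)"
  using sol by (simp add: reduced_solution_def)

lemma heron16_pos: "t \<in> J \<Longrightarrow> heron16 m (\<lambda>i. Ib i t) > 0"
  using noncollinear by (simp add: noncollinear_mod_def)

lemma Ib_pos: "t \<in> J \<Longrightarrow> Ib 0 t > 0" "t \<in> J \<Longrightarrow> Ib 1 t > 0" "t \<in> J \<Longrightarrow> Ib 2 t > 0"
  using noncollinear_mod_pos[OF masses noncollinear] by auto

lemma Itot_Ib_pos: "t \<in> J \<Longrightarrow> Itot (\<lambda>i. Ib i t) > 0"
  using Ib_pos[of t] by (simp add: Itot_def)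

lemma Ib_derivatives:
  assumes "i < 3" "t \<in> J"
  shows "(Ib i has_vector_derivative deriv (Ib i) t) (at t)"
    "(deriv (Ib i) has_vector_derivative deriv (deriv (Ib i)) t) (at t)"
  using sol assms
  by (auto simp: reduced_solution_def reduced_newton_at_def has_real_derivative_iff_has_vector_derivative)

lemma td_Ib: "i < 3 \<Longrightarrow> twice_differentiable_on (Ib i) J"
  using Ib_derivatives by (rule twice_differentiable_onI)

lemma td_Itot: "twice_differentiable_on (\<lambda>t. Itot (\<lambda>i. Ib i t)) J"
  unfolding Itot_def by (intro td_intros td_Ib) simp_all

lemma td_rsq:
  assumes "3 - j - k < 3"
  shows "twice_differentiable_on (\<lambda>t. rsq m (\<lambda>i. Ib i t) j k) J"
  unfolding rsq_def by (intro td_intros td_Itot td_Ib assms)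

lemma td_Delta: "twice_differentiable_on (\<lambda>t. Delta_mod m eps (\<lambda>i. Ib i t)) J"
proof -
  have "twice_differentiable_on (\<lambda>t. heron16 m (\<lambda>i. Ib i t)) J"
    unfolding heron16_def Let_def by (intro td_intros td_rsq) simp_all
  then show ?thesis
    unfolding Delta_mod_def by (intro td_intros heron16_pos)
qed

lemma td_vertex_ratio: "twice_differentiable_on (\<lambda>t. vertex_ratio m eps (\<lambda>i. Ib i t)) J"
proof -
  \<comment> \<open>The quotient becomes a product with the inverse of a positive real function, the
    form that the differentiability rules cover.\<close>
  have "vertex_ratio m eps I =
    (of_real ((m 2 * I 2 - m 0 * I 0 - m 1 * I 1) / 2)
      + \<i> * of_real (2 * (m 0 * m 1 * m 2) * Delta_mod m eps I)) * of_real (inverse (m 1 * I 0))" for I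
    unfolding vertex_ratio_def Complex_eq of_real_inverse by (simp only: divide_inverse)
  then show ?thesis
    by (simp only:) (intro td_intros td_Delta td_Ib mult_pos_pos mass_pos Ib_pos; simp)
qed

text \<open>Only the moments and their first derivatives occur, and both are differentiable; this is
  what makes the rotation angle twice differentiable.\<close>

lemma differentiable_omega:
  assumes t: "t \<in> J"
  shows "(\<lambda>t. omega_mod m \<Omega> eps (\<lambda>i. Ib i t) (\<lambda>i. deriv (Ib i) t) 0) differentiable (at t)"
proof -
  have I: "Ib i differentiable (at t)" "deriv (Ib i) differentiable (at t)" if "i < 3" for i
    using Ib_derivatives[OF that t] differentiableI_vector by blast+
  have D: "(\<lambda>t. Delta_mod m eps (\<lambda>i. Ib i t)) differentiable (at t)"
    and T: "(\<lambda>t. Itot (\<lambda>i. Ib i t)) differentiable (at t)"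
    using twice_differentiable_on_imp_differentiable[OF td_Delta t]
      twice_differentiable_on_imp_differentiable[OF td_Itot t] .
  have nz: "Delta_mod m eps (\<lambda>i. Ib i t) \<noteq> 0" "Itot (\<lambda>i. Ib i t) \<noteq> 0" "Ib 0 t \<noteq> 0"
    using heron16_pos[OF t] eps Itot_Ib_pos[OF t] Ib_pos(1)[OF t] by (auto simp: Delta_mod_def)
  have C: "(\<lambda>t. Ccoef m (\<lambda>i. Ib i t) i) differentiable (at t)" if "i < 3" for i
    unfolding Ccoef_def
    by (intro differentiable_add differentiable_mult differentiable_const I) (use that in auto)
  show ?thesis
    unfolding omega_mod_def omega0_def Let_def
    by (intro differentiable_add differentiable_diff differentiable_mult differentiable_divide
        differentiable_const I C D T) (use nz mass_pos in \<open>auto simp: numeral_2_eq_2\<close>)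
qed

lemma realization:
  assumes "is_interval J" "t0 \<in> J" and p: "(\<Sum>i<3. complex_of_real (m i) * p i) = 0"
    and area: "sgn (signed_area p) = eps" and init: "\<And>i. i < 3 \<Longrightarrow> m i * (cmod (p i))\<^sup>2 = Ib i t0"
  obtains a where "three_body_motion m a J" "\<And>i. i < 3 \<Longrightarrow> a i t0 = p i"
    "\<And>t. t \<in> J \<Longrightarrow> ang_mom m a t = \<Omega>"
    "\<And>i t. i < 3 \<Longrightarrow> t \<in> J \<Longrightarrow> Imom m a i t = Ib i t"
    "\<And>t. t \<in> J \<Longrightarrow> sgn (signed_area (\<lambda>i. a i t)) = eps"
proof -
  define \<omega> where "\<omega> = (\<lambda>t. omega_mod m \<Omega> eps (\<lambda>i. Ib i t) (\<lambda>i. deriv (Ib i) t) 0)"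
  have "continuous_on J \<omega>"
    unfolding \<omega>_def
    by (intro differentiable_imp_continuous_on differentiable_at_imp_differentiable_on differentiable_omega)
  \<comment> \<open>Starting at the argument of p0 puts body 0 at its prescribed place; the length
    agrees through the moment.\<close>
  then obtain \<phi> where phi0: "\<phi> t0 = Arg (p 0)"
    and phi: "\<And>t. t \<in> J \<Longrightarrow> (\<phi> has_vector_derivative \<omega> t) (at t)"
    using antiderivative_open_interval[OF open_J assms(1,2)] by blast
  have td_phi: "twice_differentiable_on \<phi> J"
    using phi differentiable_omega unfolding \<omega>_def by (rule twice_differentiable_onI')
  define r where "r = (\<lambda>t. sqrt (Ib 0 t * inverse (m 0)))"
  have td_r: "twice_differentiable_on r J"
    unfolding r_def by (intro td_intros td_Ib mult_pos_pos) (simp_all add: mass_pos Ib_pos)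
  define a0 where "a0 = (\<lambda>t. complex_of_real (r t) * cis (\<phi> t))"
  define a1 where "a1 = (\<lambda>t. a0 t * vertex_ratio m eps (\<lambda>i. Ib i t))"
  define a2 where "a2 = (\<lambda>t. - (complex_of_real (m 0) * a0 t + complex_of_real (m 1) * a1 t) / complex_of_real (m 2))"
  \<comment> \<open>Indices above 2 repeat \<open>a2\<close>, so derivatives can be chosen for all
    indices at once.\<close>
  define a where "a = (\<lambda>i::nat. if i = 0 then a0 else if i = 1 then a1 else a2)"
  have td0: "twice_differentiable_on a0 J"
    unfolding a0_def by (intro td_intros td_r td_phi)
  have td1: "twice_differentiable_on a1 J"
    unfolding a1_def by (intro td_intros td0 td_vertex_ratio)
  have td2: "twice_differentiable_on a2 J"
    unfolding a2_def by (intro td_intros td0 td1)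
  have "\<exists>f' f''. \<forall>t\<in>J. (a i has_vector_derivative f' t) (at t) \<and> (f' has_vector_derivative f'' t) (at t)" for i
    using td0 td1 td2 unfolding a_def twice_differentiable_on_def by simp
  then obtain v w where vw: "\<And>i t. t \<in> J \<Longrightarrow> (a i has_vector_derivative v i t) (at t)"
    "\<And>i t. t \<in> J \<Longrightarrow> (v i has_vector_derivative w i t) (at t)"
    by metis
  have r2: "m 0 * (r t)\<^sup>2 = Ib 0 t" if "t \<in> J" for t
    using Ib_pos(1)[OF that] mass_pos by (simp add: r_def)
  have M0: "m 0 * (cmod (a 0 t))\<^sup>2 = Ib 0 t" if "t \<in> J" for t
    using r2[OF that] by (simp add: a_def a0_def norm_mult power_mult_distrib)
  have a1: "a 1 t = a 0 t * vertex_ratio m eps (\<lambda>i. Ib i t)"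
    and a2: "a 2 t = - (complex_of_real (m 0) * a 0 t + complex_of_real (m 1) * a 1 t) / complex_of_real (m 2)" for t
    by (simp_all add: a_def a1_def a2_def)
  note tri = vertex_ratio_triangle[where q = "\<lambda>i. a i t" for t, OF masses noncollinear eps M0 a1 a2]
  interpret kinematics m a v w J
    using masses open_J vw centred_triangle.centre[OF tri(1)] by unfold_locales auto
  have moments: "moments m (\<lambda>i. a i t) i = Ib i t" if "i < 3" "t \<in> J" for i t
    using tri(2) that by blast
  have Imom: "Imom m a i t = Ib i t" if "i < 3" "t \<in> J" for i t
    using moments[OF that] by (simp add: Imom_def)
  have sgn: "sgn (signed_area (\<lambda>i. a i t)) = eps" if "t \<in> J" for t
    unfolding tri(3)[OF that that] Delta_mod_def using heron16_pos[OF that] eps by auto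
  have nc: "signed_area (\<lambda>i. a i t) \<noteq> 0" if "t \<in> J" for t
    using sgn[OF that] eps by auto
  have dI: "deriv (Imom m a i) t = deriv (Ib i) t" if "i < 3" "t \<in> J" for i t
    using deriv_cong_on_open[OF open_J that(2)] Imom that(1) by blast
  have ddI: "deriv (deriv (Imom m a i)) t = deriv (deriv (Ib i)) t" if "i < 3" "t \<in> J" for i t
    using deriv_cong_on_open[OF open_J that(2)] dI that(1) by blast
  have init': "a i t0 = p i" if "i < 3" for i
  proof -
    interpret p: centred_triangle m p using masses p by unfold_locales
    have "signed_area p \<noteq> 0" using area eps by auto
    note vr = p.vertex_ratio[OF this init, unfolded area]
    have "cmod (p 0) = r t0"
      using init[of 0] r2[OF \<open>t0 \<in> J\<close>] mass_pos Ib_pos(1)[OF \<open>t0 \<in> J\<close>]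
      by (intro power2_eq_imp_eq[of "cmod (p 0)"]) (simp_all add: r_def field_simps)
    then have "a 0 t0 = p 0"
      using rcis_cmod_Arg[of "p 0"] by (simp add: a_def a0_def phi0 rcis_def)
    then show ?thesis
      using vr a1[of t0] a2[of t0] less_3_cases[OF that] by auto
  qed
  have ang: "ang_mom m a t = \<Omega>" if t: "t \<in> J" for t
  proof -
    interpret t: centred_triangle m "\<lambda>i. a i t" by (rule triangle[OF t])
    obtain r' where r': "(r has_real_derivative r') (at t)"
      using td_r t unfolding twice_differentiable_on_def has_real_derivative_iff_has_vector_derivative by blast
    have "(\<phi> has_real_derivative \<omega> t) (at t)"
      using phi[OF t] by (simp add: has_real_derivative_iff_has_vector_derivative)
    from has_vector_derivative_polar[OF r' this]
    have "(a 0 has_vector_derivative Complex r' (r t * \<omega> t) * cis (\<phi> t)) (at t)"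
      by (simp add: a_def a0_def)
    then have v0: "v 0 t = Complex r' (r t * \<omega> t) * cis (\<phi> t)"
      using velocity[of 0 t] t vector_derivative_unique_at by fastforce
    have "cnj (a 0 t) * v 0 t = of_real (r t) * Complex r' (r t * \<omega> t) * (cis (\<phi> t) * cnj (cis (\<phi> t)))"
      unfolding v0 by (simp add: a_def a0_def)
    also have "cis (\<phi> t) * cnj (cis (\<phi> t)) = 1" by (simp add: complex_norm_square[symmetric] del: cis_cnj)
    finally have "cross2 (a 0 t) (v 0 t) = (r t)\<^sup>2 * \<omega> t"
      by (simp add: cross2_def power2_eq_square)
    moreover have "(cmod (a 0 t))\<^sup>2 = (r t)\<^sup>2"
      by (simp add: a_def a0_def norm_mult power_mult_distrib)
    moreover have "r t \<noteq> 0"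
      using r2[OF t] Ib_pos(1)[OF t] by auto
    ultimately have w: "cross2 (a 0 t) (v 0 t) / (cmod (a 0 t))\<^sup>2 = \<omega> t"
      by simp
    \<comment> \<open>Body 0 turns at the rate \<open>omega_mod\<close> prescribes for \<Omega>, and
      geometrically at the rate it prescribes for the actual angular momentum. The two differ by the
      difference of the momenta divided by the total moment, so the momenta agree.\<close>
    have "omega_mod m (ang_mom m a t) eps (\<lambda>i. Ib i t) (\<lambda>i. deriv (Ib i) t) 0 =
      omega_mod m (\<Sum>i<3. m i * cross2 (a i t) (v i t)) (sgn (signed_area (\<lambda>i. a i t)))
        (moments m (\<lambda>i. a i t)) (moment_rates m (\<lambda>i. a i t) (\<lambda>i. v i t)) 0"
      unfolding sgn[OF t] ang_mom_eq[OF t]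
      by (rule omega_mod_cong) (use moments dI deriv_Imom t in simp_all)
    also have "\<dots> = \<omega> t"
      using t.omega_mod_moments[OF centre_velocity[OF t] nc[OF t], of 0] w by simp
    finally show ?thesis
      using Itot_Ib_pos[OF t] unfolding \<omega>_def omega_mod_def by simp
  qed
  have newton: "complex_of_real (m i) * w i t = force m (\<lambda>i. a i t) i" if i: "i < 3" and t: "t \<in> J" for i t
  proof -
    interpret t: centred_triangle m "\<lambda>i. a i t" by (rule triangle[OF t])
    have "reduced_newton m \<Omega> eps (\<lambda>i. Ib i t) (\<lambda>i. deriv (Ib i) t) (\<lambda>i. deriv (deriv (Ib i)) t)"
      using sol t by (simp add: reduced_solution_def reduced_newton_at_def)
    then have "reduced_newton m \<Omega> eps (\<lambda>i. Imom m a i t) (\<lambda>i. deriv (Imom m a i) t) (\<lambda>i. deriv (deriv (Imom m a i)) t)"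
      by (subst reduced_newton_cong[OF Imom dI ddI]) (use t in auto)
    then have "reduced_newton_at m (ang_mom m a t) (sgn (signed_area (\<lambda>i. a i t))) (Imom m a) t"
      unfolding reduced_newton_at_def ang[OF t] sgn[OF t]
      using has_real_derivative_Imom has_real_derivative_deriv_Imom t deriv_Imom deriv_deriv_Imom by simp
    then have perp: "inner (a i t) (complex_of_real (m i) * w i t - force m (\<lambda>i. a i t) i) = 0" if "i < 3" for i
      using reduced_newton_at_Imom_iff[OF t nc[OF t]] that by blast
    have "complex_of_real (m i) * w i t - force m (\<lambda>i. a i t) i = 0"
    \<comment> \<open>The zero sum joins the fixed centre of mass to the cancellation of internal
      forces; the zero torque joins the constancy of angular momentum, just proved, to their central
      direction.\<close>
    proof (rule t.residual_force_eq_0[OF nc[OF t] _ _ _ i])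
      show "(\<Sum>i<3. complex_of_real (m i) * w i t - force m (\<lambda>i. a i t) i) = 0"
        unfolding sum_subtractf sum_force centre_acceleration[OF t] by simp
      have "cross2 x (y - z) = cross2 x y - cross2 x z" for x y z by (simp add: cross2_def algebra_simps)
      then show "(\<Sum>i<3. cross2 (a i t) (complex_of_real (m i) * w i t - force m (\<lambda>i. a i t) i)) = 0"
        using torque_force[of "\<lambda>i. a i t" m] torque_acceleration[OF ang t] by (simp add: sum_subtractf)
    qed (rule perp)
    then show ?thesis by simp
  qed
  have "three_body_motion m a J"
    using centred_triangle.noncollinear_distinct[OF triangle nc] newton by (intro three_body_motionI) auto
  then show thesis using that init' ang Imom sgn by blast
qed

end

theorem theoremE1:
  fixes m :: "nat \<Rightarrow> real" and \<Omega> t0 :: real and J :: "real set"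
  assumes "masses_ok m" and "open J" and "is_interval J" and "t0 \<in> J"
  shows
    \<comment> \<open>(1) determined by moduli curve, initial position and angular momentum\<close>
    "(\<forall>a b. three_body_motion m a J \<and> three_body_motion m b J \<and>
        (\<forall>t\<in>J. ang_mom m a t = \<Omega>) \<and> (\<forall>t\<in>J. ang_mom m b t = \<Omega>) \<and>
        \<not> collinear3 (\<lambda>i. a i t0) \<and> (\<forall>i<3. b i t0 = a i t0) \<and>
        same_moduli_curve a b J
        \<longrightarrow> (\<forall>t\<in>J. \<forall>i<3. b i t = a i t)) \<and>
    \<comment> \<open>(2) the moduli curve solves the Omega-reduced Newton equation\<close>
     (\<forall>a. three_body_motion m a J \<and> (\<forall>t\<in>J. ang_mom m a t = \<Omega>) \<and>
        \<not> collinear3 (\<lambda>i. a i t0)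
        \<longrightarrow> (\<forall>t\<in>J. \<not> collinear3 (\<lambda>i. a i t) \<longrightarrow>
               reduced_newton_at m \<Omega> (sgn (signed_area (\<lambda>i. a i t))) (Imom m a) t)) \<and>
    \<comment> \<open>(3) converse: every solution curve is realized\<close>
     (\<forall>Ib eps p. reduced_solution m \<Omega> eps Ib J \<and> (eps = 1 \<or> eps = -1) \<and>
        (\<Sum>i<3. complex_of_real (m i) * p i) = 0 \<and> \<not> collinear3 p \<and>
        sgn (signed_area p) = eps \<and> (\<forall>i<3. m i * (cmod (p i))\<^sup>2 = Ib i t0)
        \<longrightarrow> (\<exists>a. three_body_motion m a J \<and> (\<forall>i<3. a i t0 = p i) \<and>
                 (\<forall>t\<in>J. ang_mom m a t = \<Omega>) \<and>
                 (\<forall>t\<in>J. (\<forall>i<3. Imom m a i t = Ib i t) \<and>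
                         sgn (signed_area (\<lambda>i. a i t)) = eps)))"
proof (intro conjI allI impI ballI; elim conjE)
  fix a b t i
  assume "three_body_motion m a J" "three_body_motion m b J" "\<forall>t\<in>J. ang_mom m a t = \<Omega>"
    "\<forall>t\<in>J. ang_mom m b t = \<Omega>" "\<forall>i<3. b i t0 = a i t0" "same_moduli_curve a b J" "t \<in> J" "i < (3::nat)"
  then show "b i t = a i t"
    using three_body_motion_unique[OF assms, of a b t i] by simp
next
  fix a t
  assume "three_body_motion m a J" "\<forall>t\<in>J. ang_mom m a t = \<Omega>" "t \<in> J" "\<not> collinear3 (\<lambda>i. a i t)"
  then show "reduced_newton_at m \<Omega> (sgn (signed_area (\<lambda>i. a i t))) (Imom m a) t"
    using three_body_motion_reduced_newton[OF assms(1,2), of a t] by simp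
next
  fix Ib eps p
  assume sol: "reduced_solution m \<Omega> eps Ib J" "eps = 1 \<or> eps = - 1"
    and p: "(\<Sum>i<3. complex_of_real (m i) * p i) = 0" "sgn (signed_area p) = eps"
      "\<forall>i<3. m i * (cmod (p i))\<^sup>2 = Ib i t0"
  interpret reduced_curve m \<Omega> eps Ib J
    using assms sol by unfold_locales
  obtain a where "three_body_motion m a J" "\<And>i. i < 3 \<Longrightarrow> a i t0 = p i"
    "\<And>t. t \<in> J \<Longrightarrow> ang_mom m a t = \<Omega>"
    "\<And>i t. i < 3 \<Longrightarrow> t \<in> J \<Longrightarrow> Imom m a i t = Ib i t"
    "\<And>t. t \<in> J \<Longrightarrow> sgn (signed_area (\<lambda>i. a i t)) = eps"
    using realization[OF assms(3,4) p(1,2)] p(3) by blast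
  then show "\<exists>a. three_body_motion m a J \<and> (\<forall>i<3. a i t0 = p i) \<and>
                 (\<forall>t\<in>J. ang_mom m a t = \<Omega>) \<and>
                 (\<forall>t\<in>J. (\<forall>i<3. Imom m a i t = Ib i t) \<and>
                         sgn (signed_area (\<lambda>i. a i t)) = eps)"
    by blast
qed

end
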